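(* Consider a family of sparse $n\times n$ matrices $A$, each with a nested sequence of partitionings $\mathcal{P}_0,\dots,\mathcal{P}_l$ (with $l$ depending on $n$), and run the hierarchical factorization algorithm (described in the context) on the $\mathcal{H}$-tree of depth $l$ of each $A$. Let $d_i$ be the maximum size of the super-nodes at level $i$ of the $\mathcal{H}$-tree resulting from the algorithm, and suppose that $$d_i\le \alpha^{\,l-i}\,d_l \quad (1\le i\le l)\qquad\text{and}\qquad d_l=\mathcal{O}(n/2^l)=\mathcal{O}(1),$$ where $0<\alpha<\sqrt[3]{2}$ is a constant. Assume also that $\kappa_1$ and $\kappa_2$, the maximum number of super-nodes at distance $1$ and at distance $2$, respectively, from a super-node, are $\mathcal{O}(1)$ quantities. Then the cost of the algorithm is linear with respect to the problem size, i.e. it is $\mathcal{O}(n)$.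
   Context: **Asymptotics and cost.** All $\mathcal{O}(\cdot)$ constants, and $\alpha$, are independent of the matrix in the family (in particular of $n$ and $l$). The cost of the algorithm is the total number of arithmetic operations in its Compress and Eliminate steps, with dense block operations having classical cubic cost: multiplying a $p\times q$ by a $q\times r$ block costs $\mathcal{O}(pqr)$, inverting an $m\times m$ block costs $\mathcal{O}(m^3)$, and computing the low-rank approximation (e.g. truncated SVD) of an $M\times m$ block costs $\mathcal{O}(Mm^2)$. The size of a node is its number of variables. **Partitionings and adjacency graph.** A partitioning $\mathcal{P}$ is a surjective map $\{1,\dots,n\}\to\{1,\dots,n_{\mathcal{P}}\}$; its clusters are $C_j^{\mathcal{P}}=\{k:\mathcal{P}(k)=j\}$. $A_{i,j}$ denotes the submatrix of $A$ with rows in $C_i^{\mathcal{P}}$ and columns in $C_j^{\mathcal{P}}$. The adjacency graph of $A$ with partitioning $\mathcal{P}$ has vertices $v_1,\dots,v_{n_{\mathcal{P}}}$ and a directed edge $v_i\to v_j$ iff $A_{j,i}\neq 0$. Partitionings $\mathcal{P}_0,\dots,\mathcal{P}_l$ with $n_{\mathcal{P}_i}=2^i$ are nested if, for $0\le i<l$, every cluster $C_j^{\mathcal{P}_i}$ is the union of two clusters of $\mathcal{P}_{i+1}$ (its children, which are siblings of each other). Clusters of $\mathcal{P}_l$ are leaf clusters. A cluster $C_1$ is a descendant of a cluster $C_2$ iff $C_1\subseteq C_2$. **$\mathcal{H}$-tree.** For every $1\le i\le l$ and $1\le j\le 2^{i-1}$ there are: a black-node $b_j^{[i]}$ corresponding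 to the cluster $C_j^{\mathcal{P}_{i-1}}$; and two red-nodes ${r_0}_j^{[i]},{r_1}_j^{[i]}$ corresponding to the two children (clusters of $\mathcal{P}_i$) of $C_j^{\mathcal{P}_{i-1}}$. This pair of red-nodes is called the super-node $s_j^{[i]}$, which corresponds to $C_j^{\mathcal{P}_{i-1}}$. There is also one red-node corresponding to the root cluster (of $\mathcal{P}_0$). The superscript is the level; $l$ is the depth. $\mathbb{P}(b_j^{[i]})$, the parent of $b_j^{[i]}$, is the red-node corresponding to $C_j^{\mathcal{P}_{i-1}}$. Each node carries a vector of variables and of equations, and each interaction edge $e_{u\to v}$ carries a matrix block $\mathrm{Mat}(e_{u\to v})$. Initially, interaction edges exist only between the level-$l$ red-nodes, which with these edges form the adjacency graph of $A$ with partitioning $\mathcal{P}_l$ (with the corresponding blocks of $A$). "Edge" means interaction edge. **Adjacency, well-separation, distance.** Two leaf clusters $C_p^{\mathcal{P}_l},C_q^{\mathcal{P}_l}$ are adjacent iff $A_{p,q}\ne0$ or $A_{q,p}\neq 0$. Two clusters (of any levels) are adjacent iff some leaf descendant of one is adjacent to some leaf descendant of the other. Two nodes of the $\mathcal{H}$-tree (red, black or super) are well-separated if their corresponding clusters are not adjacent; an edge joining two well-separated nodes is a well-separated edge. Distance: let nodes $u,v$ correspond to clusters $C_j^{\mathcal{P}_i}$ and $C_{j'}^{\mathcal{P}_{i'}}$ with $i\le i'$, and let $C_k^{\mathcal{P}_i}$ be the cluster of $\mathcal{P}_i$ containing $C_{j'}^{\mathcal{P}_{i'}}$. The distance between $u$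 and $v$ is the number of edges of a shortest path between $v_j$ and $v_k$ in the adjacency graph of $A$ with partitioning $\mathcal{P}_i$, edge directions being ignored. Nodes are well-separated iff their distance is greater than $1$. In the definition of $\kappa_1,\kappa_2$ the super-nodes counted are those of the same level as the given super-node, and the maximum is over all super-nodes of all levels. **Algorithm.** For $i=l,l-1,\dots,1$: first, for $j=1,\dots,2^{i-1}$, apply MergeRedNodes$({r_0}_j^{[i]},{r_1}_j^{[i]})$, forming $s_j^{[i]}$; then, for $j=1,\dots,2^{i-1}$ in turn, apply Compress$(s_j^{[i]})$, Eliminate$(s_j^{[i]})$, Eliminate$(b_j^{[i]})$. - MergeRedNodes: the two red-nodes are replaced by the single node $s_j^{[i]}$ with concatenated variables and right-hand sides. All edges from the red-nodes of $s_j^{[i]}$ to those of $s_{j'}^{[i]}$ are replaced by one edge $s_j^{[i]}\to s_{j'}^{[i]}$ carrying the $2\times 2$ block matrix of their blocks (present iff at least one of the replaced edges is present). - Compress$(s)$, $s=s_j^{[i]}$ of size $m$: let $p_1,\dots,p_t$ be the not-yet-eliminated nodes joined to $s$ by well-separated edges (each is a super-node of level $i$ or a red-node of level $i-1$). Let $A_k=\mathrm{Mat}(e_{s\to p_k})$ and $B_k^{\top}=\mathrm{Mat}(e_{p_k\to s})$. Compute a low-rank approximation $[A_1;\dots;A_t;B_1;\dots;B_t]\simeq[R_1;\dots;R_t;Q_1;\dots;Q_t]V^{\top}$ (vertical concatenation), where $V$ is $m\times r$, $r\le m$. Give the nodes $b=b_j^{[i]}$ and $\mathbb{P}(b)$ new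 variable vectors of size $r$ ($r=0$ if $t=0$). Remove all edges between $s$ and $p_1,\dots,p_t$; add edges $\mathbb{P}(b)\to p_k$ with block $R_k$ and $p_k\to\mathbb{P}(b)$ with block $Q_k^{\top}$ for each $k$; add edges $s\to b$ with block $V^{\top}$, $b\to s$ with block $V$, and $b\to\mathbb{P}(b)$, $\mathbb{P}(b)\to b$ with block $-I_r$. - Eliminate$(v)$: for every edge $e_{v\to w}$ and every edge $e_{u\to v}$ with $u,w\neq v$ not yet eliminated, add the block $-\mathrm{Mat}(e_{v\to w})\,\mathrm{Mat}(e_{v\to v})^{-1}\,\mathrm{Mat}(e_{u\to v})$ to the edge $e_{u\to w}$, creating that edge if it does not exist. The node $v$ is then eliminated, and takes no further part in the process. Pivot blocks $\mathrm{Mat}(e_{v\to v})$ are assumed invertible whenever used. *)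

theory Defs
  imports
    "HOL-Library.Landau_Symbols"
    "HOL-Library.Extended_Nat"
    "Jordan_Normal_Form.DL_Submatrix"
    "Jordan_Normal_Form.Gauss_Jordan_Elimination"
begin

text \<open>
  Matrix indices, clusters of a partitioning and nodes within a level are numbered from 0;
  levels are numbered as usual, the leaves having level \<open>l\<close>.
\<close>

section \<open>Matrices with nested partitionings\<close>

text \<open>
  \<open>part X i k\<close> is the number of the cluster of the partitioning \<open>P\<^sub>i\<close> that contains the index \<open>k\<close>.
  \<open>child0 X i j\<close> and \<open>child1 X i j\<close> are the numbers in \<open>P\<^sub>i\<^sub>+\<^sub>1\<close> of the two children of the
  \<open>j\<close>-th cluster of \<open>P\<^sub>i\<close>; no relation between the numberings of consecutive
  partitionings is imposed.
\<close>

record 'a partitioned_matrix =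
  mtx :: "'a mat"
  depth :: nat
  part :: "nat \<Rightarrow> nat \<Rightarrow> nat"
  child0 :: "nat \<Rightarrow> nat \<Rightarrow> nat"
  child1 :: "nat \<Rightarrow> nat \<Rightarrow> nat"

definition order_of :: "('a, 'b) partitioned_matrix_scheme \<Rightarrow> nat" where
  "order_of X = dim_row (mtx X)"

definition cluster :: "('a, 'b) partitioned_matrix_scheme \<Rightarrow> nat \<Rightarrow> nat \<Rightarrow> nat set" where
  "cluster X i j = {k. k < order_of X \<and> part X i k = j}"

definition nested_partitionings :: "('a, 'b) partitioned_matrix_scheme \<Rightarrow> bool" where
  "nested_partitionings X \<longleftrightarrow>
     (\<forall>i\<le>depth X. part X i ` {..<order_of X} = {..<2 ^ i}) \<and>
     (\<forall>i<depth X. \<forall>j<2 ^ i.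
        child0 X i j < 2 ^ (i + 1) \<and> child1 X i j < 2 ^ (i + 1) \<and>
        child0 X i j \<noteq> child1 X i j \<and>
        cluster X i j = cluster X (i + 1) (child0 X i j) \<union> cluster X (i + 1) (child1 X i j))"

definition partitioned_square_matrix :: "('a, 'b) partitioned_matrix_scheme \<Rightarrow> bool" where
  "partitioned_square_matrix X \<longleftrightarrow> square_mat (mtx X) \<and> nested_partitionings X"

text \<open>The block $A_{p,q}$ with respect to the partitioning \<open>P\<^sub>i\<close>.\<close>

definition block ::
  "('a, 'b) partitioned_matrix_scheme \<Rightarrow> nat \<Rightarrow> nat \<Rightarrow> nat \<Rightarrow> 'a mat" where
  "block X i p q = submatrix (mtx X) (cluster X i p) (cluster X i q)"

definition nonzero_mat :: "'a :: zero mat \<Rightarrow> bool" where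
  "nonzero_mat M \<longleftrightarrow> M \<noteq> 0\<^sub>m (dim_row M) (dim_col M)"

section \<open>Adjacency and distance\<close>

definition adjacency_graph ::
  "('a :: zero, 'b) partitioned_matrix_scheme \<Rightarrow> nat \<Rightarrow> (nat \<times> nat) set" where
  "adjacency_graph X i = {(p, q). p < 2 ^ i \<and> q < 2 ^ i \<and> nonzero_mat (block X i q p)}"

text \<open>The distance is \<open>\<infinity>\<close> if there is no path.\<close>

definition cluster_distance ::
  "('a :: zero, 'b) partitioned_matrix_scheme \<Rightarrow> nat \<Rightarrow> nat \<Rightarrow> nat \<Rightarrow> enat" where
  "cluster_distance X i j k =
     (let E = adjacency_graph X i in Inf {enat d | d. (j, k) \<in> (E \<union> E\<inverse>) ^^ d})"

definition adjacent_leaves ::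
  "('a :: zero, 'b) partitioned_matrix_scheme \<Rightarrow> nat \<Rightarrow> nat \<Rightarrow> bool" where
  "adjacent_leaves X p q \<longleftrightarrow>
     nonzero_mat (block X (depth X) p q) \<or> nonzero_mat (block X (depth X) q p)"

fun adjacent_clusters ::
  "('a :: zero, 'b) partitioned_matrix_scheme \<Rightarrow> nat \<times> nat \<Rightarrow> nat \<times> nat \<Rightarrow> bool" where
  "adjacent_clusters X (i, j) (i', j') \<longleftrightarrow>
     (\<exists>p < 2 ^ depth X. \<exists>q < 2 ^ depth X.
        cluster X (depth X) p \<subseteq> cluster X i j \<and>
        cluster X (depth X) q \<subseteq> cluster X i' j' \<and>
        adjacent_leaves X p q)"

section \<open>The hierarchical tree\<close>

text \<open>
  \<open>Red i k\<close> is the red-node of the \<open>k\<close>-th cluster of \<open>P\<^sub>i\<close>, whereas \<open>Super i j\<close> and \<open>Black i j\<close>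
  (nodes of level \<open>i\<close>) belong to the \<open>j\<close>-th cluster of \<open>P\<^sub>i\<^sub>-\<^sub>1\<close>.  Hence the two red-nodes of
  \<open>Super i j\<close> are \<open>Red i (child0 X (i - 1) j)\<close> and \<open>Red i (child1 X (i - 1) j)\<close>, and the parent
  of \<open>Black i j\<close> is \<open>Red (i - 1) j\<close>.
\<close>

datatype node = Red nat nat | Super nat nat | Black nat nat

fun node_cluster :: "node \<Rightarrow> nat \<times> nat" where
  "node_cluster (Red i k) = (i, k)"
| "node_cluster (Super i j) = (i - 1, j)"
| "node_cluster (Black i j) = (i - 1, j)"

definition well_separated ::
  "('a :: zero, 'b) partitioned_matrix_scheme \<Rightarrow> node \<Rightarrow> node \<Rightarrow> bool" where
  "well_separated X u v \<longleftrightarrow> \<not> adjacent_clusters X (node_cluster u) (node_cluster v)"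

text \<open>
  Two nodes of the same cluster may count as well-separated here if the cluster has zero diagonal
  block, although their distance is 0.  The algorithm only compares nodes of distinct clusters
  of one partitioning, and these are adjacent iff their distance is 1.
\<close>

text \<open>
  In a state, \<open>nvars T u\<close> is the size of the node \<open>u\<close>, and \<open>edge T u v\<close> is the block carried by
  the interaction edge \<open>u \<rightarrow> v\<close>, or \<open>None\<close> if there is no such edge.  Its rows are the equations
  of \<open>v\<close>, its columns the variables of \<open>u\<close>.
\<close>

record 'a htree =
  nvars :: "node \<Rightarrow> nat"
  edge :: "node \<Rightarrow> node \<Rightarrow> 'a mat option"
  eliminated :: "node set"

text \<open>An absent edge counts as a zero block where a block is needed.\<close>

definition Mat :: "('a :: zero, 'b) htree_scheme \<Rightarrow> node \<Rightarrow> node \<Rightarrow> 'a mat" where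
  "Mat T u v = (case edge T u v of Some M \<Rightarrow> M | None \<Rightarrow> 0\<^sub>m (nvars T v) (nvars T u))"

definition initial_htree :: "('a :: zero, 'b) partitioned_matrix_scheme \<Rightarrow> 'a htree" where
  "initial_htree X =
     \<lparr> nvars = (\<lambda>u. case u of
          Red i k \<Rightarrow> (if i = depth X \<and> k < 2 ^ i then card (cluster X i k) else 0)
        | _ \<Rightarrow> 0),
       edge = (\<lambda>u v. case (u, v) of
          (Red i p, Red i' q) \<Rightarrow>
            (if i = depth X \<and> i' = depth X \<and> (p, q) \<in> adjacency_graph X (depth X)
             then Some (block X (depth X) q p) else None)
        | _ \<Rightarrow> None),
       eliminated = {} \<rparr>"

section \<open>The steps of the algorithm\<close>

text \<open>
  The operation counts of the dense block kernels: \<open>mult_cost p q r\<close> for multiplying a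
  \<open>p \<times> q\<close> by a \<open>q \<times> r\<close> block, \<open>inverse_cost m\<close> for inverting an \<open>m \<times> m\<close> block and
  \<open>lowrank_cost M m\<close> for a low-rank approximation of an \<open>M \<times> m\<close> block.  With the
  filter \<open>principal UNIV\<close> the bounds hold for all block sizes with fixed constants.
\<close>

record cost_model =
  mult_cost :: "nat \<Rightarrow> nat \<Rightarrow> nat \<Rightarrow> nat"
  inverse_cost :: "nat \<Rightarrow> nat"
  lowrank_cost :: "nat \<Rightarrow> nat \<Rightarrow> nat"

definition classical_cubic_cost :: "cost_model \<Rightarrow> bool" where
  "classical_cubic_cost cm \<longleftrightarrow>
     (\<lambda>(p, q, r). real (mult_cost cm p q r)) \<in> O[principal UNIV](\<lambda>(p, q, r). real (p * q * r)) \<and>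
     (\<lambda>m. real (inverse_cost cm m)) \<in> O[principal UNIV](\<lambda>m. real (m ^ 3)) \<and>
     (\<lambda>(M, m). real (lowrank_cost cm M m)) \<in> O[principal UNIV](\<lambda>(M, m). real (M * m\<^sup>2))"

subsection \<open>Merging\<close>

text \<open>
  All merges of one level at once: the $2 \times 2$ block matrix of an edge between two
  super-nodes only involves edges between red-nodes of that level.
\<close>

definition merge_level ::
  "('a :: zero, 'b) partitioned_matrix_scheme \<Rightarrow> nat \<Rightarrow> 'a htree \<Rightarrow> 'a htree" where
  "merge_level X i T =
     (let r0 = (\<lambda>j. Red i (child0 X (i - 1) j));
          r1 = (\<lambda>j. Red i (child1 X (i - 1) j));
          is_new = (\<lambda>i' j. i' = i \<and> j < 2 ^ (i - 1))
      in T \<lparr>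
        nvars := (\<lambda>u. case u of
            Super i' j \<Rightarrow> (if is_new i' j then nvars T (r0 j) + nvars T (r1 j) else nvars T u)
          | _ \<Rightarrow> nvars T u),
        edge := (\<lambda>u v. case (u, v) of
            (Super i' j, Super i'' j') \<Rightarrow>
              (if is_new i' j \<and> is_new i'' j' then
                 (if \<exists>x\<in>{r0 j, r1 j}. \<exists>y\<in>{r0 j', r1 j'}. edge T x y \<noteq> None
                  then Some (four_block_mat
                    (Mat T (r0 j) (r0 j')) (Mat T (r1 j) (r0 j'))
                    (Mat T (r0 j) (r1 j')) (Mat T (r1 j) (r1 j')))
                  else None)
               else edge T u v)
          | (Red i' _, Red i'' _) \<Rightarrow> (if i' = i \<and> i'' = i then None else edge T u v)
          | _ \<Rightarrow> edge T u v) \<rparr>)"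

subsection \<open>Compression\<close>

definition stack_rows :: "nat \<Rightarrow> 'a :: zero mat list \<Rightarrow> 'a mat" where
  "stack_rows m Ms = foldr (@\<^sub>r) Ms (0\<^sub>m 0 m)"

definition separated_neighbours ::
  "('a :: zero, 'b) partitioned_matrix_scheme \<Rightarrow> 'a htree \<Rightarrow> node \<Rightarrow> node set" where
  "separated_neighbours X T s =
     {p. p \<noteq> s \<and> p \<notin> eliminated T \<and> (edge T s p \<noteq> None \<or> edge T p s \<noteq> None) \<and>
         well_separated X s p}"

text \<open>
  \<open>compress_result i j ps r R Q V T\<close> is the tree after the compression of \<open>Super i j\<close>, whose
  well-separated neighbours are \<open>ps\<close>, by means of a low-rank approximation with factors
  \<open>R p\<close>, \<open>Q p\<close> (for \<open>p\<close> in \<open>ps\<close>) and \<open>V\<close>.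
\<close>

definition compress_result ::
  "nat \<Rightarrow> nat \<Rightarrow> node set \<Rightarrow> nat \<Rightarrow> (node \<Rightarrow> 'a mat) \<Rightarrow> (node \<Rightarrow> 'a mat) \<Rightarrow> 'a mat
     \<Rightarrow> 'a :: comm_ring_1 htree \<Rightarrow> 'a htree" where
  "compress_result i j ps r R Q V T =
     (let s = Super i j; b = Black i j; P = Red (i - 1) j in
      T \<lparr> nvars := (nvars T)(b := r, P := r),
          edge := (\<lambda>u v.
            if u = P \<and> v \<in> ps then Some (R v)
            else if u \<in> ps \<and> v = P then Some (transpose_mat (Q u))
            else if u = s \<and> v \<in> ps \<or> u \<in> ps \<and> v = s then None
            else if u = s \<and> v = b then Some (transpose_mat V)
            else if u = b \<and> v = s then Some V
            else if u = b \<and> v = P \<or> u = P \<and> v = b then Some (- 1\<^sub>m r)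
            else edge T u v) \<rparr>)"

text \<open>
  The rank and the factors of the low-rank approximation are not determined by the algorithm.
  The relation \<open>approx\<close> is the accuracy criterion that the approximation has to meet.
\<close>

definition compress_step ::
  "('a mat \<Rightarrow> 'a mat \<Rightarrow> bool) \<Rightarrow> cost_model \<Rightarrow> ('a :: comm_ring_1, 'b) partitioned_matrix_scheme
     \<Rightarrow> nat \<Rightarrow> nat \<Rightarrow> 'a htree \<Rightarrow> nat \<Rightarrow> 'a htree \<Rightarrow> bool" where
  "compress_step approx cm X i j T c T' \<longleftrightarrow>
     (\<exists>ps r R Q V.
        let s = Super i j; m = nvars T s;
            M = stack_rows m (map (\<lambda>p. Mat T s p) ps @ map (\<lambda>p. transpose_mat (Mat T p s)) ps);
            L = stack_rows r (map R ps @ map Q ps)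
        in distinct ps \<and> set ps = separated_neighbours X T s \<and>
           r \<le> m \<and> (ps = [] \<longrightarrow> r = 0) \<and>
           (\<forall>p \<in> set ps. R p \<in> carrier_mat (nvars T p) r \<and> Q p \<in> carrier_mat (nvars T p) r) \<and>
           V \<in> carrier_mat m r \<and>
           approx M (L * transpose_mat V) \<and>
           T' = compress_result i j (set ps) r R Q V T \<and>
           c = lowrank_cost cm (dim_row M) m)"

subsection \<open>Elimination\<close>

definition targets :: "'a htree \<Rightarrow> node \<Rightarrow> node set" where
  "targets T v = {w. w \<noteq> v \<and> w \<notin> eliminated T \<and> edge T v w \<noteq> None}"

definition sources :: "'a htree \<Rightarrow> node \<Rightarrow> node set" where
  "sources T v = {u. u \<noteq> v \<and> u \<notin> eliminated T \<and> edge T u v \<noteq> None}"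

definition pivot_used :: "'a htree \<Rightarrow> node \<Rightarrow> bool" where
  "pivot_used T v \<longleftrightarrow> targets T v \<noteq> {} \<and> sources T v \<noteq> {}"

definition eliminate :: "node \<Rightarrow> 'a :: field htree \<Rightarrow> 'a htree" where
  "eliminate v T = T \<lparr>
     edge := (\<lambda>u w.
       if u \<in> sources T v \<and> w \<in> targets T v
       then Some (Mat T u w - Mat T v w * the (mat_inverse (Mat T v v)) * Mat T u v)
       else edge T u w),
     eliminated := insert v (eliminated T) \<rparr>"

text \<open>
  One inversion of the pivot block; then, for every pair of an incoming and an outgoing edge,
  two multiplications and a subtraction (one operation per entry).
\<close>

definition eliminate_cost :: "cost_model \<Rightarrow> node \<Rightarrow> 'a htree \<Rightarrow> nat" where
  "eliminate_cost cm v T =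
     (let n = nvars T; m = n v in
      (if pivot_used T v then inverse_cost cm m else 0) +
      (\<Sum>u\<in>sources T v. \<Sum>w\<in>targets T v.
         mult_cost cm (n w) m m + mult_cost cm (n w) m (n u) + n w * n u))"

definition eliminate_step ::
  "cost_model \<Rightarrow> node \<Rightarrow> 'a :: field htree \<Rightarrow> nat \<Rightarrow> 'a htree \<Rightarrow> bool" where
  "eliminate_step cm v T c T' \<longleftrightarrow>
     (pivot_used T v \<longrightarrow> invertible_mat (Mat T v v)) \<and>
     T' = eliminate v T \<and> c = eliminate_cost cm v T"

section \<open>The algorithm\<close>

datatype operation = MergeLevel nat | Compress nat nat | Eliminate node

definition hierarchical_factorization :: "nat \<Rightarrow> operation list" where
  "hierarchical_factorization l =
     concat (map (\<lambda>i. MergeLevel i #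
       concat (map (\<lambda>j. [Compress i j, Eliminate (Super i j), Eliminate (Black i j)])
                   [0..<2 ^ (i - 1)]))
       (rev [1..<l + 1]))"

text \<open>Only the Compress and Eliminate steps contribute to the cost.\<close>

fun step ::
  "('a mat \<Rightarrow> 'a mat \<Rightarrow> bool) \<Rightarrow> cost_model \<Rightarrow> ('a :: field, 'b) partitioned_matrix_scheme
     \<Rightarrow> operation \<Rightarrow> 'a htree \<Rightarrow> nat \<Rightarrow> 'a htree \<Rightarrow> bool" where
  "step approx cm X (MergeLevel i) T c T' \<longleftrightarrow> T' = merge_level X i T \<and> c = 0"
| "step approx cm X (Compress i j) T c T' \<longleftrightarrow> compress_step approx cm X i j T c T'"
| "step approx cm X (Eliminate v) T c T' \<longleftrightarrow> eliminate_step cm v T c T'"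

inductive exec ::
  "('a mat \<Rightarrow> 'a mat \<Rightarrow> bool) \<Rightarrow> cost_model \<Rightarrow> ('a :: field, 'b) partitioned_matrix_scheme
     \<Rightarrow> operation list \<Rightarrow> 'a htree \<Rightarrow> nat \<Rightarrow> 'a htree \<Rightarrow> bool"
  for approx cm X where
  exec_Nil: "exec approx cm X [] T 0 T"
| exec_Cons: "exec approx cm X (opn # ops) T (c + c') T''"
    if "step approx cm X opn T c T'" and "exec approx cm X ops T' c' T''"

text \<open>
  \<open>factorization_run approx cm X c T\<close>: some run of the algorithm on \<open>X\<close> ends, at total
  cost \<open>c\<close>, in the tree \<open>T\<close>.
\<close>

definition factorization_run ::
  "('a mat \<Rightarrow> 'a mat \<Rightarrow> bool) \<Rightarrow> cost_model \<Rightarrow> ('a :: field, 'b) partitioned_matrix_scheme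
     \<Rightarrow> nat \<Rightarrow> 'a htree \<Rightarrow> bool" where
  "factorization_run approx cm X c T \<longleftrightarrow>
     exec approx cm X (hierarchical_factorization (depth X)) (initial_htree X) c T"

section \<open>The quantities in the complexity estimate\<close>

text \<open>
  Both maxima below are 0 where there are no super-nodes, i.e. for a tree of depth 0.
\<close>

text \<open>
  The number $d_i$.  The size of a super-node is set when it is formed and never changes, so it
  can be read off the final tree.
\<close>

definition max_super_size :: "'a htree \<Rightarrow> nat \<Rightarrow> nat" where
  "max_super_size T i = Max (insert 0 {nvars T (Super i j) | j. 1 \<le> i \<and> j < 2 ^ (i - 1)})"

text \<open>
  \<open>kappa X 1\<close> and \<open>kappa X 2\<close> are the numbers $\kappa_1$ and $\kappa_2$; the super-nodes of
  level \<open>i\<close> belong to the clusters of \<open>P\<^sub>i\<^sub>-\<^sub>1\<close>.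
\<close>

definition kappa :: "('a :: zero, 'b) partitioned_matrix_scheme \<Rightarrow> nat \<Rightarrow> nat" where
  "kappa X e = Max (insert 0
     {card {k. k < 2 ^ (i - 1) \<and> cluster_distance X (i - 1) j k = enat e}
        | i j. 1 \<le> i \<and> i \<le> depth X \<and> j < 2 ^ (i - 1)})"

end

theory Submission
  imports Defs
begin

text \<open>
  The cost is linear because the factorization stays sparse: at no time does an edge join two
  clusters at distance greater than 2.  Identify a super-node of level \<open>g + 1\<close>, the
  black-node beside it and the red-node that takes its place with their common cluster of \<open>P\<^sub>g\<close>.
  Compression removes from a super-node all edges to clusters at distance 2 and hands them to
  the red-node of the same cluster, so that the following eliminations of the super-node and of the
  black-node only join neighbours of one cluster, which are at distance at most 2 from each other
  (\<open>invariant_compress\<close>, \<open>edges_within_eliminate\<close>).  When a level is finished, only red-nodes have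
  edges, and merging them passes to the parent clusters, which does not increase distances
  (\<open>invariant_merge_level\<close>).

  Therefore every node has at most \<open>K = 3 (1 + \<kappa>\<^sub>1 + \<kappa>\<^sub>2)\<close> neighbours, three nodes for each cluster at
  distance at most 2.  All nodes of a level have at most the size \<open>D\<close> of its largest super-node,
  since compression does not produce more variables than it finds, and so one cluster costs
  \<open>O (K\<^sup>2 D\<^sup>3)\<close> (\<open>process_cluster\<close>).  There are \<open>2 ^ g\<close> clusters in \<open>P\<^sub>g\<close>, which gives a
  sum of \<open>2 ^ g d\<^sub>g\<^sub>+\<^sub>1\<^sup>3\<close> over the levels.  Because \<open>\<alpha>\<^sup>3 < 2\<close>, it is bounded by a
  geometric sum in which the leaf term dominates (\<open>sum_levels_le\<close>), and this term, \<open>2 ^ l d\<^sub>l\<^sup>3\<close> up to a constant, is \<open>O (n)\<close>: one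
  factor \<open>d\<^sub>l = O (n / 2 ^ l)\<close> cancels \<open>2 ^ l\<close> and the other two are bounded.
\<close>

section \<open>Nested clusters\<close>

lemma cluster_nonempty:
  assumes "partitioned_square_matrix X" "i \<le> depth X" "j < 2 ^ i"
  shows "cluster X i j \<noteq> {}"
proof -
  have "j \<in> part X i ` {..<order_of X}"
    using assms by (simp add: partitioned_square_matrix_def nested_partitionings_def)
  then show ?thesis by (auto simp: cluster_def)
qed

lemma cluster_cong_index:
  assumes "a \<in> cluster X i j" "a \<in> cluster X i k"
  shows "j = k"
  using assms by (auto simp: cluster_def)

text \<open>
  The numberings of consecutive partitionings are unrelated, so the parent of a cluster has to be
  found through one of its elements.
\<close>

lemma cluster_subset_parent:
  assumes "partitioned_square_matrix X" "Suc g \<le> depth X" "x < 2 ^ Suc g"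
  obtains a where "a < 2 ^ g" "cluster X (Suc g) x \<subseteq> cluster X g a"
proof -
  obtain k where k: "k \<in> cluster X (Suc g) x"
    using cluster_nonempty assms by blast
  define a where "a = part X g k"
  have range: "part X g ` {..<order_of X} = {..<2 ^ g}"
    using assms(1,2) by (auto simp: partitioned_square_matrix_def nested_partitionings_def)
  have "k < order_of X"
    using k by (simp add: cluster_def)
  then have "k \<in> cluster X g a" and a: "a < 2 ^ g"
    using range by (auto simp: cluster_def a_def)
  moreover have children:
    "cluster X g a = cluster X (Suc g) (child0 X g a) \<union> cluster X (Suc g) (child1 X g a)"
    using assms(1,2) a by (auto simp: partitioned_square_matrix_def nested_partitionings_def)
  ultimately have "x = child0 X g a \<or> x = child1 X g a"
    using k cluster_cong_index by blast
  with children that[OF a] show ?thesis by blast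
qed

lemma child_less:
  assumes "partitioned_square_matrix X" "Suc g \<le> depth X" "a < 2 ^ g"
  shows "child0 X g a < 2 ^ Suc g" "child1 X g a < 2 ^ Suc g"
  using assms by (auto simp: partitioned_square_matrix_def nested_partitionings_def)

lemma cluster_child_subset:
  assumes "partitioned_square_matrix X" "Suc g \<le> depth X" "a < 2 ^ g"
    and "x \<in> {child0 X g a, child1 X g a}"
  shows "cluster X (Suc g) x \<subseteq> cluster X g a"
  using assms by (auto simp: partitioned_square_matrix_def nested_partitionings_def)

text \<open>
  The entries of a block sit at positions of the submatrix and not at those of the matrix.
  In terms of the original indices, a block is nonzero iff it contains a nonzero entry of the
  matrix, and in this form adjacency is obviously inherited by larger clusters.
\<close>

lemma nonzero_block_iff:
  assumes "partitioned_square_matrix X"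
  shows "nonzero_mat (block X i p q) \<longleftrightarrow>
    (\<exists>a\<in>cluster X i p. \<exists>b\<in>cluster X i q. mtx X $$ (a, b) \<noteq> 0)"
proof -
  let ?A = "mtx X" and ?I = "cluster X i p" and ?J = "cluster X i q"
  have sq: "dim_col ?A = dim_row ?A"
    using assms by (simp add: partitioned_square_matrix_def)
  have sub: "cluster X i r \<subseteq> {..<dim_row ?A}" for r
    by (auto simp: cluster_def order_of_def)
  have Icard: "{a. a < dim_row ?A \<and> a \<in> cluster X i r} = cluster X i r" for r
    using sub by auto
  show ?thesis
  proof
    assume "nonzero_mat (block X i p q)"
    then obtain s t where st: "s < card ?I" "t < card ?J"
      and nz: "block X i p q $$ (s, t) \<noteq> 0"
      unfolding nonzero_mat_def block_def
      by (auto simp: mat_eq_iff dim_submatrix sq Icard)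
    have "block X i p q $$ (s, t) = ?A $$ (pick ?I s, pick ?J t)"
      unfolding block_def using st by (intro submatrix_index) (auto simp: sq Icard)
    moreover have "pick ?I s \<in> ?I" "pick ?J t \<in> ?J"
      using st by (auto intro: pick_in_set_le)
    ultimately show "\<exists>a\<in>?I. \<exists>b\<in>?J. ?A $$ (a, b) \<noteq> 0"
      using nz by metis
  next
    assume "\<exists>a\<in>?I. \<exists>b\<in>?J. ?A $$ (a, b) \<noteq> 0"
    then obtain a b where ab: "a \<in> ?I" "b \<in> ?J" and nz: "?A $$ (a, b) \<noteq> 0"
      by blast
    let ?s = "card {x\<in>?I. x < a}" and ?t = "card {x\<in>?J. x < b}"
    have fin: "finite (cluster X i r)" for r
      using sub finite_subset by blast
    have "?s < card ?I" "?t < card ?J"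
      using ab by (auto intro!: psubset_card_mono fin)
    moreover have "block X i p q $$ (?s, ?t) = ?A $$ (a, b)"
      unfolding block_def using ab sub sq by (intro submatrix_index_card) auto
    ultimately show "nonzero_mat (block X i p q)"
      unfolding nonzero_mat_def using nz
      by (simp add: mat_eq_iff block_def dim_submatrix sq Icard) metis
  qed
qed

lemma nonzero_block_mono:
  assumes "partitioned_square_matrix X" "nonzero_mat (block X i p q)"
    and "cluster X i p \<subseteq> cluster X i' p'" "cluster X i q \<subseteq> cluster X i' q'"
  shows "nonzero_mat (block X i' p' q')"
  using assms(2-4) unfolding nonzero_block_iff[OF assms(1)] by blast

section \<open>Clusters at distance at most two\<close>

text \<open>
  Distance at most 1.  The relation is made reflexive so that its square is distance at most 2.
\<close>

definition touching :: "('a :: zero, 'b) partitioned_matrix_scheme \<Rightarrow> nat \<Rightarrow> (nat \<times> nat) set" where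
  "touching X g = (adjacency_graph X g \<union> (adjacency_graph X g)\<inverse>)\<^sup>="

abbreviation within_two ::
  "('a :: zero, 'b) partitioned_matrix_scheme \<Rightarrow> nat \<Rightarrow> (nat \<times> nat) set" where
  "within_two X g \<equiv> touching X g O touching X g"

lemma touching_refl [simp]: "(a, a) \<in> touching X g"
  by (simp add: touching_def)

lemma touching_sym: "(a, b) \<in> touching X g \<Longrightarrow> (b, a) \<in> touching X g"
  by (auto simp: touching_def)

lemma within_two_sym: "(a, b) \<in> within_two X g \<Longrightarrow> (b, a) \<in> within_two X g"
  by (meson relcomp.simps touching_sym)

lemma touching_within_two: "(a, b) \<in> touching X g \<Longrightarrow> (a, b) \<in> within_two X g"
  using touching_refl by blast

lemma touching_less:
  assumes "(a, b) \<in> touching X g" "a < 2 ^ g"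
  shows "b < 2 ^ g"
  using assms by (auto simp: touching_def adjacency_graph_def)

lemma within_two_less:
  assumes "(a, b) \<in> within_two X g" "a < 2 ^ g"
  shows "b < 2 ^ g"
  using assms touching_less by blast

text \<open>
  The geometric core of compression: adjacency is decided at the leaves, and a nonzero
  leaf block lies inside the block of the two larger clusters.  So the edges that compression
  leaves at a super-node lead to clusters at distance at most 1.
\<close>

lemma adjacent_clusters_touching:
  assumes "partitioned_square_matrix X" "j < 2 ^ g" "k < 2 ^ g"
    and "adjacent_clusters X (g, j) (g, k)"
  shows "(j, k) \<in> touching X g"
proof -
  have "nonzero_mat (block X g j k) \<or> nonzero_mat (block X g k j)"
    using assms(4) nonzero_block_mono[OF assms(1)] by (fastforce simp: adjacent_leaves_def)
  then show ?thesis
    using assms(2,3) by (auto simp: touching_def adjacency_graph_def)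
qed

lemma touching_parents:
  assumes X: "partitioned_square_matrix X" and g: "Suc g \<le> depth X"
    and xy: "(x, y) \<in> touching X (Suc g)"
    and x: "x < 2 ^ Suc g" and ab: "a < 2 ^ g" "b < 2 ^ g"
    and sub: "cluster X (Suc g) x \<subseteq> cluster X g a" "cluster X (Suc g) y \<subseteq> cluster X g b"
  shows "(a, b) \<in> touching X g"
proof (cases "x = y")
  case True
  then have "a = b"
    using sub cluster_nonempty[OF X g x] cluster_cong_index by blast
  then show ?thesis by simp
next
  case False
  then have "nonzero_mat (block X (Suc g) x y) \<or> nonzero_mat (block X (Suc g) y x)"
    using xy by (auto simp: touching_def adjacency_graph_def)
  then have "nonzero_mat (block X g a b) \<or> nonzero_mat (block X g b a)"
    using nonzero_block_mono[OF X] sub by blast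
  then show ?thesis
    using ab by (auto simp: touching_def adjacency_graph_def)
qed

text \<open>
  Passing to parents contracts the adjacency graph, so distances do not grow from one level to
  the next coarser one.
\<close>

lemma within_two_parents:
  assumes X: "partitioned_square_matrix X" and g: "Suc g \<le> depth X"
    and xy: "(x, y) \<in> within_two X (Suc g)"
    and x: "x < 2 ^ Suc g" and ab: "a < 2 ^ g" "b < 2 ^ g"
    and sub: "cluster X (Suc g) x \<subseteq> cluster X g a" "cluster X (Suc g) y \<subseteq> cluster X g b"
  shows "(a, b) \<in> within_two X g"
proof -
  from xy obtain z where z: "(x, z) \<in> touching X (Suc g)" "(z, y) \<in> touching X (Suc g)"
    by blast
  have "z < 2 ^ Suc g"
    using touching_less[OF z(1) x] .
  moreover from this obtain c where "c < 2 ^ g" "cluster X (Suc g) z \<subseteq> cluster X g c"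
    using cluster_subset_parent[OF X g] by blast
  ultimately show ?thesis
    using touching_parents[OF X g z(1) x ab(1) _ sub(1)] touching_parents[OF X g z(2) _ _ ab(2) _ sub(2)]
    by blast
qed

text \<open>
  The index shift is the one between the level of a super-node and that of its cluster.
\<close>

lemma card_distance_le_kappa:
  assumes "Suc g \<le> depth X" "j < 2 ^ g"
  shows "card {k. k < 2 ^ g \<and> cluster_distance X g j k = enat e} \<le> kappa X e"
proof -
  let ?S = "{card {k. k < 2 ^ (i - 1) \<and> cluster_distance X (i - 1) j k = enat e}
        | i j. 1 \<le> i \<and> i \<le> depth X \<and> j < 2 ^ (i - 1)}"
  have "?S \<subseteq> (\<lambda>(i, j). card {k. k < 2 ^ (i - 1) \<and> cluster_distance X (i - 1) j k = enat e}) `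
      (SIGMA i:{..depth X}. {..<2 ^ (i - 1)})"
    by auto
  then have "finite ?S"
    by (rule finite_subset) auto
  moreover have "card {k. k < 2 ^ g \<and> cluster_distance X g j k = enat e} \<in> ?S"
    using assms by (intro CollectI exI[of _ "Suc g"] exI[of _ j]) auto
  ultimately show ?thesis
    unfolding kappa_def by (intro Max_ge) auto
qed

lemma cluster_distance_attained:
  assumes "(j, k) \<in> (adjacency_graph X g \<union> (adjacency_graph X g)\<inverse>) ^^ d"
  obtains d' where "d' \<le> d" "cluster_distance X g j k = enat d'"
    "(j, k) \<in> (adjacency_graph X g \<union> (adjacency_graph X g)\<inverse>) ^^ d'"
proof -
  let ?S = "{enat d | d. (j, k) \<in> (adjacency_graph X g \<union> (adjacency_graph X g)\<inverse>) ^^ d}"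
  have d: "enat d \<in> ?S" using assms by blast
  then have "Inf ?S \<in> ?S"
    by (auto simp: Inf_enat_def intro: LeastI)
  moreover have "Inf ?S \<le> enat d"
    using d by (rule Inf_lower)
  ultimately show ?thesis
    using that by (auto simp: cluster_distance_def Let_def)
qed

text \<open>
  This is where the hypotheses on \<open>\<kappa>\<^sub>1\<close> and \<open>\<kappa>\<^sub>2\<close> enter: the clusters reached by at most two steps
  are the cluster itself and those at distance exactly 1 or 2.
\<close>

lemma within_two_neighbourhood:
  assumes "Suc g \<le> depth X" "j < 2 ^ g"
  shows "finite (within_two X g `` {j})"
    and "card (within_two X g `` {j}) \<le> 1 + kappa X 1 + kappa X 2"
proof -
  let ?G = "adjacency_graph X g \<union> (adjacency_graph X g)\<inverse>"
  let ?at = "\<lambda>e. {k. k < 2 ^ g \<and> cluster_distance X g j k = enat e}"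
  have "k \<in> {j} \<union> ?at 1 \<union> ?at 2" if "(j, k) \<in> within_two X g" for k
  proof -
    have "(j, k) \<in> ?G ^^ 0 \<union> ?G ^^ 1 \<union> ?G ^^ 2"
      using that by (auto simp: touching_def numeral_2_eq_2)
    then have "\<exists>d\<le>2. (j, k) \<in> ?G ^^ d"
      by (metis UnE le_refl one_le_numeral zero_le)
    then obtain d where d: "d \<le> 2" "(j, k) \<in> ?G ^^ d"
      by blast
    obtain d' where d': "d' \<le> d" "cluster_distance X g j k = enat d'" "(j, k) \<in> ?G ^^ d'"
      using cluster_distance_attained[OF d(2)] .
    then have "d' = 0 \<or> d' = 1 \<or> d' = 2"
      using d(1) by linarith
    then show ?thesis
      using d' within_two_less[OF that assms(2)] by auto
  qed
  then have sub: "within_two X g `` {j} \<subseteq> {j} \<union> ?at 1 \<union> ?at 2"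
    by blast
  then show "finite (within_two X g `` {j})"
    by (rule finite_subset) auto
  have "card (within_two X g `` {j}) \<le> card ({j} \<union> ?at 1 \<union> ?at 2)"
    using sub by (intro card_mono) auto
  also have "\<dots> \<le> card {j} + card (?at 1) + card (?at 2)"
    by (meson card_Un_le add_right_mono order_trans)
  also have "\<dots> \<le> 1 + kappa X 1 + kappa X 2"
    using card_distance_le_kappa[OF assms] by (intro add_mono) auto
  finally show "card (within_two X g `` {j}) \<le> 1 + kappa X 1 + kappa X 2" .
qed

section \<open>Only clusters at distance at most two interact\<close>

definition index :: "node \<Rightarrow> nat" where
  "index u = snd (node_cluster u)"

lemma index_simps [simp]:
  "index (Red i k) = k" "index (Super i k) = k" "index (Black i k) = k"
  by (simp_all add: index_def)

text \<open>
  The set \<open>N\<close> confines the ends of all edges between nodes that are still present, and \<open>F\<close>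
  contains the nodes that are about to be eliminated, whose edges have to be even shorter:
  elimination joins any two neighbours of the eliminated node.  The dimensions of the blocks are
  needed because the cost of a compression is measured by the height of an actual matrix.
\<close>

definition edges_within ::
  "('a :: zero, 'b) partitioned_matrix_scheme \<Rightarrow> nat \<Rightarrow> node set \<Rightarrow> node set \<Rightarrow> 'a htree \<Rightarrow> bool"
where
  "edges_within X g N F T \<longleftrightarrow>
     (\<forall>u v M. edge T u v = Some M \<longrightarrow> u \<notin> eliminated T \<longrightarrow> v \<notin> eliminated T \<longrightarrow>
        u \<in> N \<and> v \<in> N \<and> M \<in> carrier_mat (nvars T v) (nvars T u) \<and>
        (index u, index v) \<in> within_two X g \<and>
        (u \<in> F \<or> v \<in> F \<longrightarrow> (index u, index v) \<in> touching X g))"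

lemma edges_withinD:
  assumes "edges_within X g N F T" "edge T u v = Some M" "u \<notin> eliminated T" "v \<notin> eliminated T"
  shows "u \<in> N" "v \<in> N" "M \<in> carrier_mat (nvars T v) (nvars T u)"
    "(index u, index v) \<in> within_two X g"
    "u \<in> F \<or> v \<in> F \<Longrightarrow> (index u, index v) \<in> touching X g"
  using assms unfolding edges_within_def by blast+

lemma Mat_carrier:
  assumes "edges_within X g N F T" "u \<notin> eliminated T" "v \<notin> eliminated T"
  shows "Mat T u v \<in> carrier_mat (nvars T v) (nvars T u)"
  using assms by (auto simp: Mat_def edges_within_def split: option.split)

text \<open>
  The nodes that can have edges after the first \<open>j\<close> clusters of \<open>P\<^sub>g\<close> have been processed: the
  super-nodes (of level \<open>g + 1\<close>) of the remaining clusters, and the red-nodes that replace the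
  processed ones.
\<close>

definition live_nodes :: "nat \<Rightarrow> nat \<Rightarrow> node set" where
  "live_nodes g j = {Super (Suc g) k | k. j \<le> k \<and> k < 2 ^ g} \<union> {Red g k | k. k < j}"

text \<open>
  An upper bound for the set of eliminated nodes.  Facts about edges concern nodes that
  are still present, and this bound shows that the nodes in use are present.
\<close>

definition gone_nodes :: "nat \<Rightarrow> nat \<Rightarrow> node set" where
  "gone_nodes g j = {u. case u of
       Red i k \<Rightarrow> False
     | Super i k \<Rightarrow> Suc g < i \<or> i = Suc g \<and> k < j
     | Black i k \<Rightarrow> Suc g < i \<or> i = Suc g \<and> k < j}"

text \<open>
  The case \<open>j = 0\<close> describes the tree after the merge of level \<open>g + 1\<close>, and \<open>j = 2 ^ g\<close> the tree
  before the merge of level \<open>g\<close>, when only red-nodes are left.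
\<close>

definition invariant ::
  "('a :: zero, 'b) partitioned_matrix_scheme \<Rightarrow> nat \<Rightarrow> nat \<Rightarrow> 'a htree \<Rightarrow> bool" where
  "invariant X g j T \<longleftrightarrow>
     eliminated T \<subseteq> gone_nodes g j \<and> edges_within X g (live_nodes g j) {} T"

lemma live_not_gone:
  assumes "u \<in> live_nodes g j"
  shows "u \<notin> gone_nodes g j"
  using assms by (auto simp: live_nodes_def gone_nodes_def)

lemma live_nodes_end: "live_nodes g (2 ^ g) = {Red g k | k. k < 2 ^ g}"
  by (auto simp: live_nodes_def)

lemma invariant_initial:
  assumes X: "partitioned_square_matrix X"
  shows "invariant X (depth X) (2 ^ depth X) (initial_htree X)"
proof -
  let ?T = "initial_htree X" and ?l = "depth X"
  have "u \<in> live_nodes ?l (2 ^ ?l) \<and> v \<in> live_nodes ?l (2 ^ ?l) \<and>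
      M \<in> carrier_mat (nvars ?T v) (nvars ?T u) \<and> (index u, index v) \<in> within_two X ?l"
    if e: "edge ?T u v = Some M" for u v M
  proof -
    from e obtain p q where uv: "u = Red ?l p" "v = Red ?l q"
      and pq: "(p, q) \<in> adjacency_graph X ?l" and M: "M = block X ?l q p"
      by (auto simp: initial_htree_def split: node.splits if_splits)
    have less: "p < 2 ^ ?l" "q < 2 ^ ?l"
      using pq by (auto simp: adjacency_graph_def)
    have "{a. a < dim_row (mtx X) \<and> a \<in> cluster X ?l r} = cluster X ?l r" for r
      by (auto simp: cluster_def order_of_def)
    moreover have "dim_col (mtx X) = dim_row (mtx X)"
      using X by (simp add: partitioned_square_matrix_def)
    ultimately have "M \<in> carrier_mat (card (cluster X ?l q)) (card (cluster X ?l p))"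
      unfolding M block_def by (intro carrier_matI) (simp_all add: dim_submatrix)
    moreover have "(p, q) \<in> touching X ?l"
      using pq by (simp add: touching_def)
    ultimately show ?thesis
      using less touching_within_two by (auto simp: live_nodes_end uv initial_htree_def)
  qed
  then show ?thesis
    by (simp add: invariant_def edges_within_def) (simp add: initial_htree_def)
qed

subsection \<open>Merging\<close>

lemma nvars_merge_level_Super:
  assumes "j < 2 ^ g"
  shows "nvars (merge_level X (Suc g) T) (Super (Suc g) j) =
    nvars T (Red (Suc g) (child0 X g j)) + nvars T (Red (Suc g) (child1 X g j))"
  using assms by (simp add: merge_level_def Let_def)

lemma eliminated_merge_level [simp]: "eliminated (merge_level X i T) = eliminated T"
  by (simp add: merge_level_def Let_def)

lemma edge_merge_level_cases:
  assumes "edge (merge_level X (Suc g) T) u v = Some M"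
  obtains
    (merged) j k x y where "u = Super (Suc g) j" "v = Super (Suc g) k" "j < 2 ^ g" "k < 2 ^ g"
      "x \<in> {child0 X g j, child1 X g j}" "y \<in> {child0 X g k, child1 X g k}"
      "edge T (Red (Suc g) x) (Red (Suc g) y) \<noteq> None"
      "M = four_block_mat
         (Mat T (Red (Suc g) (child0 X g j)) (Red (Suc g) (child0 X g k)))
         (Mat T (Red (Suc g) (child1 X g j)) (Red (Suc g) (child0 X g k)))
         (Mat T (Red (Suc g) (child0 X g j)) (Red (Suc g) (child1 X g k)))
         (Mat T (Red (Suc g) (child1 X g j)) (Red (Suc g) (child1 X g k)))"
  | (old) "edge T u v = Some M" "\<not> (\<exists>x y. u = Red (Suc g) x \<and> v = Red (Suc g) y)"
proof -
  consider (both) j k where "u = Super (Suc g) j" "v = Super (Suc g) k" "j < 2 ^ g" "k < 2 ^ g"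
    | (other) "\<not> (\<exists>j k. u = Super (Suc g) j \<and> v = Super (Suc g) k \<and> j < 2 ^ g \<and> k < 2 ^ g)"
    by blast
  then show thesis
  proof cases
    case both
    let ?r = "\<lambda>x. Red (Suc g) x"
    have "\<exists>x\<in>{?r (child0 X g j), ?r (child1 X g j)}.
        \<exists>y\<in>{?r (child0 X g k), ?r (child1 X g k)}. edge T x y \<noteq> None"
      and M: "M = four_block_mat
         (Mat T (?r (child0 X g j)) (?r (child0 X g k))) (Mat T (?r (child1 X g j)) (?r (child0 X g k)))
         (Mat T (?r (child0 X g j)) (?r (child1 X g k))) (Mat T (?r (child1 X g j)) (?r (child1 X g k)))"
      using assms both by (simp_all add: merge_level_def Let_def split: if_splits)
    then obtain x y where "x \<in> {child0 X g j, child1 X g j}" "y \<in> {child0 X g k, child1 X g k}"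
      "edge T (?r x) (?r y) \<noteq> None"
      by auto
    then show thesis
      using merged[OF both _ _ _ M] by blast
  next
    case other
    with assms show thesis
      by (intro old) (auto simp: merge_level_def Let_def split: node.splits if_splits)
  qed
qed

text \<open>
  An edge between super-nodes stems from an edge between children of their clusters, so the
  bound on the distance survives because contraction to the parents does not increase distances.
\<close>

lemma invariant_merge_level:
  assumes X: "partitioned_square_matrix X" and g: "Suc g \<le> depth X"
    and inv: "invariant X (Suc g) (2 ^ Suc g) T"
  shows "invariant X g 0 (merge_level X (Suc g) T)"
proof -
  let ?T = "merge_level X (Suc g) T"
  have el: "eliminated T \<subseteq> gone_nodes (Suc g) (2 ^ Suc g)"
    and edges: "edges_within X (Suc g) {Red (Suc g) k | k. k < 2 ^ Suc g} {} T"
    using inv unfolding invariant_def live_nodes_end by blast+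
  have red: "Red i k \<notin> eliminated T" for i k
    using el by (auto simp: gone_nodes_def)
  have "u \<in> live_nodes g 0 \<and> v \<in> live_nodes g 0 \<and> M \<in> carrier_mat (nvars ?T v) (nvars ?T u) \<and>
      (index u, index v) \<in> within_two X g"
    if e: "edge ?T u v = Some M" and act: "u \<notin> eliminated T" "v \<notin> eliminated T" for u v M
    using e
  proof (cases rule: edge_merge_level_cases)
    case (merged j k x y)
    have "M \<in> carrier_mat (nvars ?T v) (nvars ?T u)"
      unfolding merged(8) merged(1,2) nvars_merge_level_Super[OF merged(3)]
        nvars_merge_level_Super[OF merged(4)]
      by (intro four_block_carrier_mat Mat_carrier[OF edges] red)
    moreover from merged(7) have "(x, y) \<in> within_two X (Suc g)"
      using edges_withinD(4)[OF edges _ red red] by fastforce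
    then have "(j, k) \<in> within_two X g"
      using merged(3-6) cluster_child_subset[OF X g] child_less[OF X g]
      by (intro within_two_parents[OF X g]) auto
    ultimately show ?thesis
      using merged(1-4) by (auto simp: live_nodes_def)
  next
    case old
    \<comment> \<open>All edges present before the merge join red-nodes of this level, and these are replaced.\<close>
    then show ?thesis
      using edges_withinD(1,2)[OF edges old(1) act] by auto
  qed
  moreover have "eliminated T \<subseteq> gone_nodes g 0"
    using el by (rule order_trans) (auto simp: gone_nodes_def split: node.splits)
  ultimately show ?thesis
    by (simp add: invariant_def edges_within_def)
qed

subsection \<open>Compression\<close>

lemma separated_neighbours_edges:
  assumes edges: "edges_within X g N F T" and s: "s \<notin> eliminated T"
    and p: "p \<in> separated_neighbours X T s"
  shows "p \<in> N" "p \<noteq> s" "p \<notin> eliminated T" "(index s, index p) \<in> within_two X g"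
proof -
  have p: "p \<noteq> s" "p \<notin> eliminated T" "edge T s p \<noteq> None \<or> edge T p s \<noteq> None"
    using p by (auto simp: separated_neighbours_def)
  then show "p \<noteq> s" "p \<notin> eliminated T" by auto
  from p(3) consider M where "edge T s p = Some M" | M where "edge T p s = Some M"
    by auto
  then have "p \<in> N \<and> (index s, index p) \<in> within_two X g"
  proof cases
    case 1
    show ?thesis
      using edges_withinD(2,4)[OF edges 1 s p(2)] by blast
  next
    case 2
    show ?thesis
      using edges_withinD(1,4)[OF edges 2 p(2) s] within_two_sym by blast
  qed
  then show "p \<in> N" "(index s, index p) \<in> within_two X g" by auto
qed

text \<open>
  The red-node takes over the long edges of the super-node; it belongs to the same cluster, so they
  still have length at most 2.  The super-node keeps its edges to adjacent clusters, and the
  black-node only meets nodes of its own cluster.  All edges of these two nodes thus become short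
  enough for the nodes to be eliminated.
\<close>

lemma invariant_compress:
  assumes X: "partitioned_square_matrix X" and g: "Suc g \<le> depth X" and j: "j < 2 ^ g"
    and inv: "invariant X g j T"
    and size: "\<forall>u\<in>live_nodes g j. nvars T u \<le> D"
    and step: "compress_step approx cm X (Suc g) j T c T'"
  defines "s \<equiv> Super (Suc g) j" and "b \<equiv> Black (Suc g) j" and "P \<equiv> Red g j"
  shows "eliminated T' = eliminated T"
    and "edges_within X g (live_nodes g j \<union> {P, b}) {s, b} T'"
    and "\<forall>u\<in>live_nodes g j \<union> {P, b}. nvars T' u \<le> D"
proof -
  let ?ps = "separated_neighbours X T s"
  obtain ps r R Q V where set_ps: "set ps = ?ps" and r: "r \<le> nvars T s"
    and RQ': "\<forall>p\<in>set ps. R p \<in> carrier_mat (nvars T p) r \<and> Q p \<in> carrier_mat (nvars T p) r"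
    and V: "V \<in> carrier_mat (nvars T s) r"
    and T'': "T' = compress_result (Suc g) j (set ps) r R Q V T"
    using step unfolding compress_step_def Let_def s_def by blast
  note RQ = RQ'[unfolded set_ps] and T' = T''[unfolded set_ps]
  have act: "u \<notin> eliminated T" if "u \<in> live_nodes g j" for u
    using inv that live_not_gone by (auto simp: invariant_def)
  have edges: "edges_within X g (live_nodes g j) {} T"
    using inv by (simp add: invariant_def)
  have s: "s \<in> live_nodes g j" "s \<notin> eliminated T" and P: "P \<notin> live_nodes g j"
    and b: "b \<notin> live_nodes g j"
    using j act by (auto simp: s_def P_def b_def live_nodes_def)
  have ps: "p \<in> live_nodes g j \<and> p \<noteq> s \<and> (j, index p) \<in> within_two X g" if "p \<in> ?ps" for p
    using separated_neighbours_edges[OF edges s(2) that] by (simp add: s_def)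
  have nv: "nvars T' u = (if u = P \<or> u = b then r else nvars T u)" for u
    by (auto simp: T' compress_result_def Let_def P_def b_def)
  show el: "eliminated T' = eliminated T"
    by (simp add: T' compress_result_def Let_def)
  show "\<forall>u\<in>live_nodes g j \<union> {P, b}. nvars T' u \<le> D"
    using size r order_trans[OF r] s(1) by (simp add: nv)
  have close: "(j, index p) \<in> touching X g"
    if p: "p \<in> live_nodes g j" "p \<notin> ?ps" "p \<noteq> s" "edge T s p \<noteq> None \<or> edge T p s \<noteq> None" for p
  proof -
    have "node_cluster p = (g, index p)" "index p < 2 ^ g"
      using p(1) j by (auto simp: live_nodes_def)
    moreover have "\<not> well_separated X s p"
      using p act by (auto simp: separated_neighbours_def)
    ultimately show ?thesis
      using adjacent_clusters_touching[OF X j, of "index p"]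
      by (simp add: well_separated_def s_def del: adjacent_clusters.simps)
  qed
  have "u \<in> live_nodes g j \<union> {P, b} \<and> v \<in> live_nodes g j \<union> {P, b} \<and>
      M \<in> carrier_mat (nvars T' v) (nvars T' u) \<and> (index u, index v) \<in> within_two X g \<and>
      (u \<in> {s, b} \<or> v \<in> {s, b} \<longrightarrow> (index u, index v) \<in> touching X g)"
    if e: "edge T' u v = Some M" and uv: "u \<notin> eliminated T" "v \<notin> eliminated T" for u v M
  proof -
    consider
        (R) "u = P" "v \<in> ?ps" "M = R v"
      | (Q) "u \<in> ?ps" "v = P" "M = transpose_mat (Q u)"
      | (down) "u = s" "v = b" "M = transpose_mat V"
      | (up) "u = b" "v = s" "M = V"
      | (id) "u = b \<and> v = P \<or> u = P \<and> v = b" "M = - 1\<^sub>m r"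
      | (old) "edge T u v = Some M" "\<not> (u = s \<and> v \<in> ?ps)" "\<not> (u \<in> ?ps \<and> v = s)"
    proof -
      have "edge T' u v =
          (if u = P \<and> v \<in> ?ps then Some (R v)
           else if u \<in> ?ps \<and> v = P then Some (transpose_mat (Q u))
           else if u = s \<and> v \<in> ?ps \<or> u \<in> ?ps \<and> v = s then None
           else if u = s \<and> v = b then Some (transpose_mat V)
           else if u = b \<and> v = s then Some V
           else if u = b \<and> v = P \<or> u = P \<and> v = b then Some (- 1\<^sub>m r)
           else edge T u v)"
        by (simp add: T' compress_result_def Let_def s_def b_def P_def)
      then show thesis
        using e that by (smt (verit, best) option.distinct(1) option.inject)
    qed
    then show ?thesis
    proof cases
      case R
      have "v \<noteq> P" "v \<noteq> b" "v \<noteq> s" "u \<noteq> s" "u \<noteq> b" "index u = j"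
        using ps[OF R(2)] P b R(1) by (auto simp: P_def b_def s_def)
      then show ?thesis
        using RQ R ps[OF R(2)] by (simp add: nv)
    next
      case Q
      have "u \<noteq> P" "u \<noteq> b" "u \<noteq> s" "v \<noteq> s" "v \<noteq> b" "index v = j"
        using ps[OF Q(1)] P b Q(2) by (auto simp: P_def b_def s_def)
      then show ?thesis
        using RQ Q ps[OF Q(1)] by (simp add: nv within_two_sym)
    next
      case down
      have "s \<noteq> P" "s \<noteq> b" "index s = j" "index b = j"
        by (simp_all add: P_def b_def s_def)
      then show ?thesis
        using V s down by (simp add: nv touching_within_two)
    next
      case up
      have "s \<noteq> P" "s \<noteq> b" "index s = j" "index b = j"
        by (simp_all add: P_def b_def s_def)
      then show ?thesis
        using V s up by (simp add: nv touching_within_two)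
    next
      case id
      then have "index u = j" "index v = j" "nvars T' u = r" "nvars T' v = r"
        by (auto simp: nv b_def P_def)
      then show ?thesis
        using id by (auto simp: touching_within_two)
    next
      case old
      note D = edges_withinD(1-4)[OF edges old(1) uv]
      have ne: "u \<noteq> P" "u \<noteq> b" "v \<noteq> P" "v \<noteq> b"
        using D(1,2) P b by blast+
      have "(index u, index v) \<in> touching X g" if "u = s"
      proof (cases "v = s")
        case False
        then show ?thesis
          using close[OF D(2)] old that by (simp add: s_def)
      qed (simp add: that)
      moreover have "(index u, index v) \<in> touching X g" if "v = s"
      proof (cases "u = s")
        case False
        then have "(j, index u) \<in> touching X g"
          using close[OF D(1)] old that by simp
        then show ?thesis
          using touching_sym that by (simp add: s_def)
      qed (simp add: that)
      ultimately show ?thesis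
        using D ne by (simp add: nv)
    qed
  qed
  then show "edges_within X g (live_nodes g j \<union> {P, b}) {s, b} T'"
    unfolding edges_within_def el by blast
qed

subsection \<open>Elimination\<close>

lemma targets_edges:
  assumes "edges_within X g N F T" "v \<notin> eliminated T" "w \<in> targets T v"
  shows "w \<in> N" "(index v, index w) \<in> within_two X g"
    "v \<in> F \<Longrightarrow> (index v, index w) \<in> touching X g"
  using assms by (auto simp: targets_def edges_within_def)

lemma sources_edges:
  assumes "edges_within X g N F T" "v \<notin> eliminated T" "u \<in> sources T v"
  shows "u \<in> N" "(index u, index v) \<in> within_two X g"
    "v \<in> F \<Longrightarrow> (index u, index v) \<in> touching X g"
  using assms by (auto simp: sources_def edges_within_def)

text \<open>
  Two neighbours of a node whose edges stay at distance at most 1 are at distance at most 2.  If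
  one of them lies in \<open>F\<close> it belongs to the same cluster as the eliminated node, and then the new
  edge is as short as the edge it comes from.
\<close>

lemma edges_within_eliminate:
  assumes edges: "edges_within X g N F T"
    and v: "v \<in> F" "v \<notin> eliminated T"
    and F: "\<forall>u\<in>F. index u = index v"
  shows "edges_within X g (N - {v}) F (eliminate v T)"
proof -
  have "u \<in> N \<and> w \<in> N \<and> M \<in> carrier_mat (nvars T w) (nvars T u) \<and>
      (index u, index w) \<in> within_two X g \<and>
      (u \<in> F \<or> w \<in> F \<longrightarrow> (index u, index w) \<in> touching X g)"
    if e: "edge (eliminate v T) u w = Some M"
      and act: "u \<notin> eliminated T" "w \<notin> eliminated T" for u w M
  proof (cases "u \<in> sources T v \<and> w \<in> targets T v")
    case True
    then have u: "u \<in> sources T v" and w: "w \<in> targets T v" by auto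
    have M: "M = Mat T u w - Mat T v w * the (mat_inverse (Mat T v v)) * Mat T u v"
      using e True by (simp add: eliminate_def)
    have "M \<in> carrier_mat (nvars T w) (nvars T u)"
      unfolding M using Mat_carrier[OF edges v(2) act(2)] Mat_carrier[OF edges act(1) v(2)]
      by (intro carrier_matI) auto
    moreover note uv = sources_edges(3)[OF edges v(2) u v(1)]
      and vw = targets_edges(3)[OF edges v(2) w v(1)]
    moreover have "(index u, index w) \<in> touching X g" if "u \<in> F \<or> w \<in> F"
      using that F uv vw by auto
    ultimately show ?thesis
      using sources_edges(1)[OF edges v(2) u] targets_edges(1)[OF edges v(2) w] by blast
  next
    case False
    then have "edge T u w = Some M"
      using e by (auto simp: eliminate_def)
    then show ?thesis
      using edges_withinD[OF edges _ act] by blast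
  qed
  then show ?thesis
    by (simp add: edges_within_def) (simp add: eliminate_def)
qed

section \<open>The cost of one cluster\<close>

definition kernels_bounded :: "real \<Rightarrow> cost_model \<Rightarrow> bool" where
  "kernels_bounded C cm \<longleftrightarrow>
     (\<forall>p q r. real (mult_cost cm p q r) \<le> C * real (p * q * r)) \<and>
     (\<forall>m. real (inverse_cost cm m) \<le> C * real (m ^ 3)) \<and>
     (\<forall>M m. real (lowrank_cost cm M m) \<le> C * real (M * m\<^sup>2))"

lemma classical_cubic_cost_bounded:
  assumes "classical_cubic_cost cm"
  obtains C where "C \<ge> 0" "kernels_bounded C cm"
proof -
  obtain c1 where c1: "\<And>p q r. real (mult_cost cm p q r) \<le> c1 * real (p * q * r)"
    using assms unfolding classical_cubic_cost_def
    by (elim conjE landau_o.bigE) (auto simp: eventually_principal)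
  obtain c2 where c2: "\<And>m. real (inverse_cost cm m) \<le> c2 * real (m ^ 3)"
    using assms unfolding classical_cubic_cost_def
    by (elim conjE landau_o.bigE) (auto simp: eventually_principal)
  obtain c3 where c3: "\<And>M m. real (lowrank_cost cm M m) \<le> c3 * real (M * m\<^sup>2)"
    using assms unfolding classical_cubic_cost_def
    by (elim conjE landau_o.bigE) (auto simp: eventually_principal)
  define C where "C = max 0 (max c1 (max c2 c3))"
  have "c * real x \<le> C * real x" if "c \<in> {c1, c2, c3}" for c x
    using that by (intro mult_right_mono) (auto simp: C_def)
  then have "kernels_bounded C cm"
    unfolding kernels_bounded_def using c1 c2 c3 by (meson insertI1 insertI2 order_trans)
  moreover have "C \<ge> 0"
    by (simp add: C_def)
  ultimately show thesis by (rule that[rotated])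
qed

text \<open>The factor 3 counts the super-node, the red-node and the black-node of a cluster.\<close>

definition max_neighbours :: "('a :: zero, 'b) partitioned_matrix_scheme \<Rightarrow> nat" where
  "max_neighbours X = 3 * (1 + kappa X 1 + kappa X 2)"

definition level_nodes :: "nat \<Rightarrow> node set" where
  "level_nodes g = (\<Union>k. {Super (Suc g) k, Red g k, Black (Suc g) k})"

lemma live_nodes_level: "live_nodes g j \<union> {Red g j, Black (Suc g) j} \<subseteq> level_nodes g"
  by (auto simp: live_nodes_def level_nodes_def)

text \<open>
  Used for the neighbours of a node in a compression, and for the targets and the sources of a
  node in an elimination.
\<close>

lemma card_nodes_within_two:
  assumes "Suc g \<le> depth X" "j < 2 ^ g"
    and S: "\<And>u. u \<in> S \<Longrightarrow> u \<in> level_nodes g \<and> (j, index u) \<in> within_two X g"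
  shows "finite S" "card S \<le> max_neighbours X"
proof -
  let ?K = "within_two X g `` {j}"
  let ?U = "\<Union>k\<in>?K. {Super (Suc g) k, Red g k, Black (Suc g) k}"
  note K = within_two_neighbourhood[OF assms(1,2)]
  have sub: "S \<subseteq> ?U"
    using S by (fastforce simp: level_nodes_def)
  have fin: "finite ?U"
    using K(1) by blast
  show "finite S"
    using sub fin by (rule finite_subset)
  have "card S \<le> card ?U"
    using sub fin by (rule card_mono[rotated])
  also have "\<dots> \<le> (\<Sum>k\<in>?K. card {Super (Suc g) k, Red g k, Black (Suc g) k})"
    using K(1) by (rule card_UN_le)
  also have "\<dots> = 3 * card ?K"
    by simp
  also have "\<dots> \<le> max_neighbours X"
    using K(2) by (simp add: max_neighbours_def)
  finally show "card S \<le> max_neighbours X" .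
qed

lemma dim_row_stack_rows: "dim_row (stack_rows m Ms) = sum_list (map dim_row Ms)"
  by (induction Ms) (simp_all add: stack_rows_def append_rows_def)

text \<open>
  The compressed matrix has two blocks of at most \<open>D\<close> rows for each neighbour, and at most \<open>D\<close>
  columns.
\<close>

lemma compress_cost_le:
  assumes g: "Suc g \<le> depth X" and j: "j < 2 ^ g"
    and inv: "invariant X g j T"
    and size: "\<forall>u\<in>live_nodes g j. nvars T u \<le> D"
    and cm: "kernels_bounded C cm" "C \<ge> 0"
    and step: "compress_step approx cm X (Suc g) j T c T'"
  shows "real c \<le> 2 * C * real (max_neighbours X) * real D ^ 3"
proof -
  let ?s = "Super (Suc g) j"
  have edges: "edges_within X g (live_nodes g j) {} T"
    using inv by (simp add: invariant_def)
  have s: "?s \<in> live_nodes g j"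
    using j by (simp add: live_nodes_def)
  then have act: "?s \<notin> eliminated T"
    using inv live_not_gone by (auto simp: invariant_def)
  note nb = separated_neighbours_edges[OF edges act]
  obtain ps where ps: "distinct ps" "set ps = separated_neighbours X T ?s"
    and c: "c = lowrank_cost cm (dim_row (stack_rows (nvars T ?s)
      (map (\<lambda>p. Mat T ?s p) ps @ map (\<lambda>p. transpose_mat (Mat T p ?s)) ps))) (nvars T ?s)"
    using step unfolding compress_step_def Let_def by blast
  let ?rows = "sum_list (map (\<lambda>p. dim_row (Mat T ?s p)) ps) + sum_list (map (\<lambda>p. dim_col (Mat T p ?s)) ps)"
  have dims: "dim_row (Mat T ?s p) \<le> D" "dim_col (Mat T p ?s) \<le> D" if "p \<in> set ps" for p
    using nb[of p] that ps(2) size Mat_carrier[OF edges act, of p] Mat_carrier[OF edges _ act, of p]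
    by auto
  have "length ps = card (set ps)"
    using ps(1) by (simp add: distinct_card)
  also have "\<dots> \<le> max_neighbours X"
    using nb(1,4) live_nodes_level[of g j] unfolding ps(2) index_simps
    by (intro card_nodes_within_two[OF g j]) blast
  finally have len: "length ps \<le> max_neighbours X" .
  have "sum_list (map f ps) \<le> max_neighbours X * D" if "\<And>p. p \<in> set ps \<Longrightarrow> f p \<le> D" for f
  proof -
    have "sum_list (map f ps) \<le> sum_list (map (\<lambda>_. D) ps)"
      using that by (rule sum_list_mono)
    also have "\<dots> = length ps * D"
      by (simp add: sum_list_triv)
    also have "\<dots> \<le> max_neighbours X * D"
      using len by simp
    finally show ?thesis .
  qed
  then have rows: "?rows \<le> 2 * (max_neighbours X * D)"
    using dims by (metis add_mono mult_2)
  have "c = lowrank_cost cm ?rows (nvars T ?s)"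
    by (simp add: c dim_row_stack_rows comp_def)
  then have "real c \<le> C * real (?rows * (nvars T ?s)\<^sup>2)"
    using cm(1) unfolding kernels_bounded_def by blast
  also have "?rows * (nvars T ?s)\<^sup>2 \<le> 2 * (max_neighbours X * D) * D\<^sup>2"
    using rows size s by (intro mult_le_mono power_mono) auto
  then have "C * real (?rows * (nvars T ?s)\<^sup>2) \<le> C * real (2 * (max_neighbours X * D) * D\<^sup>2)"
    using cm(2) by (intro mult_left_mono) (simp_all only: of_nat_le_iff)
  also have "\<dots> = 2 * C * real (max_neighbours X) * real D ^ 3"
    by (simp add: power2_eq_square power3_eq_cube)
  finally show ?thesis .
qed

text \<open>
  One inversion, and two multiplications and a subtraction for each of the at most \<open>K\<^sup>2\<close>
  pairs of a source and a target.
\<close>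

lemma eliminate_cost_le:
  assumes g: "Suc g \<le> depth X" and edges: "edges_within X g N F T"
    and N: "N \<subseteq> level_nodes g" and v: "v \<in> N" "v \<notin> eliminated T" "index v < 2 ^ g"
    and size: "\<forall>u\<in>N. nvars T u \<le> D"
    and cm: "kernels_bounded C cm" "C \<ge> 0"
  shows "real (eliminate_cost cm v T) \<le> (C + real (max_neighbours X) ^ 2 * (2 * C + 1)) * real D ^ 3"
proof -
  let ?K = "max_neighbours X" and ?n = "nvars T"
  have m: "?n v \<le> D" using size v by blast
  note src = sources_edges[OF edges v(2)] and tgt = targets_edges[OF edges v(2)]
  have S: "card (sources T v) \<le> ?K"
    using src N within_two_sym by (intro card_nodes_within_two[OF g v(3)]) blast
  have T: "card (targets T v) \<le> ?K"
    using tgt N by (intro card_nodes_within_two[OF g v(3)]) blast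
  have "inverse_cost cm (?n v) \<le> C * real (?n v ^ 3)"
    using cm(1) by (simp add: kernels_bounded_def)
  also have "\<dots> \<le> C * real (D ^ 3)"
    using cm(2) m by (intro mult_left_mono) (simp_all add: power_mono)
  finally have inverse: "real (if pivot_used T v then inverse_cost cm (?n v) else 0) \<le> C * real D ^ 3"
    using cm(2) by simp
  have pair: "real (mult_cost cm (?n w) (?n v) (?n v) + mult_cost cm (?n w) (?n v) (?n u) + ?n w * ?n u)
      \<le> (2 * C + 1) * real D ^ 3"
    if "u \<in> sources T v" "w \<in> targets T v" for u w
  proof -
    have u: "?n u \<le> D" and w: "?n w \<le> D"
      using that src tgt size by auto
    have mult: "real (mult_cost cm (?n w) (?n v) q) \<le> C * real D ^ 3" if "q \<le> D" for q
    proof -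
      have "real (mult_cost cm (?n w) (?n v) q) \<le> C * real (?n w * ?n v * q)"
        using cm(1) by (simp add: kernels_bounded_def)
      also have "\<dots> \<le> C * real (D * D * D)"
        using cm(2) w m that by (intro mult_left_mono) (simp_all only: of_nat_le_iff mult_le_mono)
      also have "\<dots> = C * real D ^ 3"
        by (simp add: power3_eq_cube)
      finally show ?thesis .
    qed
    \<comment> \<open>Sizes are natural numbers, so the quadratic count of the subtraction is below the cubic one.\<close>
    have "?n w * ?n u \<le> D * D"
      using u w by (rule mult_le_mono[rotated])
    also have "\<dots> \<le> D ^ 3"
      by (cases D) (simp_all add: power3_eq_cube)
    finally have "real (?n w * ?n u) \<le> real D ^ 3"
      by (metis of_nat_le_iff of_nat_power)
    then show ?thesis
      using mult[OF m] mult[OF u] by (simp add: algebra_simps)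
  qed
  have "(\<Sum>u\<in>sources T v. \<Sum>w\<in>targets T v.
      real (mult_cost cm (?n w) (?n v) (?n v) + mult_cost cm (?n w) (?n v) (?n u) + ?n w * ?n u))
      \<le> (\<Sum>u\<in>sources T v. \<Sum>w\<in>targets T v. (2 * C + 1) * real D ^ 3)"
    using pair by (intro sum_mono) blast
  also have "\<dots> = real (card (sources T v) * card (targets T v)) * ((2 * C + 1) * real D ^ 3)"
    by simp
  also have "\<dots> \<le> real (?K * ?K) * ((2 * C + 1) * real D ^ 3)"
    using cm(2) S T by (intro mult_right_mono) (simp_all only: of_nat_le_iff mult_le_mono, simp)
  finally show ?thesis
    using inverse unfolding eliminate_cost_def Let_def of_nat_add of_nat_sum
    by (simp add: power2_eq_square algebra_simps)
qed

text \<open>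
  For at most \<open>K\<close> neighbours, the coefficient of \<open>D\<^sup>3\<close> in the cost of one compression and two
  eliminations.
\<close>

definition cluster_cost :: "real \<Rightarrow> real \<Rightarrow> real" where
  "cluster_cost C K = 2 * C * K + 2 * (C + K ^ 2 * (2 * C + 1))"

text \<open>
  The two eliminations leave exactly the nodes of the next index: the red-node has replaced the
  super-node, and the black-node has only existed in between.
\<close>

lemma process_cluster:
  assumes X: "partitioned_square_matrix X" and g: "Suc g \<le> depth X" and j: "j < 2 ^ g"
    and inv: "invariant X g j T"
    and size: "\<forall>u\<in>live_nodes g j. nvars T u \<le> D"
    and cm: "kernels_bounded C cm" "C \<ge> 0"
    and compress: "compress_step approx cm X (Suc g) j T c1 T1"
    and eliminate1: "eliminate_step cm (Super (Suc g) j) T1 c2 T2"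
    and eliminate2: "eliminate_step cm (Black (Suc g) j) T2 c3 T3"
  shows "invariant X g (Suc j) T3" "\<forall>u\<in>live_nodes g (Suc j). nvars T3 u \<le> D"
    and "real (c1 + c2 + c3) \<le> cluster_cost C (real (max_neighbours X)) * real D ^ 3"
proof -
  let ?s = "Super (Suc g) j" and ?b = "Black (Suc g) j"
  define N where "N = live_nodes g j \<union> {Red g j, ?b}"
  have gone: "eliminated T \<subseteq> gone_nodes g j"
    using inv by (simp add: invariant_def)
  note T1 = invariant_compress[OF X g j inv size compress, folded N_def]
  have T2: "T2 = eliminate ?s T1" "c2 = eliminate_cost cm ?s T1"
    and T3: "T3 = eliminate ?b T2" "c3 = eliminate_cost cm ?b T2"
    using eliminate1 eliminate2 by (simp_all add: eliminate_step_def)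
  have nv: "nvars T2 = nvars T1" "nvars T3 = nvars T1"
    and el: "eliminated T2 = insert ?s (eliminated T)" "eliminated T3 = insert ?b (insert ?s (eliminated T))"
    by (simp_all add: T2 T3 T1(1) eliminate_def)
  have act: "?s \<notin> eliminated T1" "?b \<notin> eliminated T2"
    using gone by (auto simp: T1(1) el gone_nodes_def)
  have edges2: "edges_within X g (N - {?s}) {?s, ?b} T2"
    unfolding T2 using act(1) by (intro edges_within_eliminate[OF T1(2)]) auto
  have "edges_within X g (N - {?s} - {?b}) {?s, ?b} T3"
    unfolding T3 using act(2) by (intro edges_within_eliminate[OF edges2]) auto
  moreover have N': "N - {?s} - {?b} = live_nodes g (Suc j)"
    using j by (auto simp: N_def live_nodes_def)
  ultimately have "edges_within X g (live_nodes g (Suc j)) {} T3"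
    by (simp add: edges_within_def)
  moreover have "eliminated T3 \<subseteq> gone_nodes g (Suc j)"
    using gone unfolding el by (auto simp: gone_nodes_def subset_iff split: node.splits)
  ultimately show "invariant X g (Suc j) T3"
    by (simp add: invariant_def)
  show "\<forall>u\<in>live_nodes g (Suc j). nvars T3 u \<le> D"
    using T1(3) N' nv by auto
  have N: "N \<subseteq> level_nodes g"
    using live_nodes_level by (simp add: N_def)
  have "?s \<in> N" "?b \<in> N - {?s}"
    using j by (auto simp: N_def live_nodes_def)
  moreover have "\<forall>u\<in>N - {?s}. nvars T2 u \<le> D"
    using T1(3) nv by auto
  ultimately have "real c2 \<le> (C + real (max_neighbours X) ^ 2 * (2 * C + 1)) * real D ^ 3"
    "real c3 \<le> (C + real (max_neighbours X) ^ 2 * (2 * C + 1)) * real D ^ 3"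
    unfolding T2(2) T3(2) using j N act
    by (intro eliminate_cost_le[OF g T1(2)] eliminate_cost_le[OF g edges2] T1(3) cm; auto)+
  then show "real (c1 + c2 + c3) \<le> cluster_cost C (real (max_neighbours X)) * real D ^ 3"
    using compress_cost_le[OF g j inv size cm compress]
    by (simp add: cluster_cost_def algebra_simps)
qed

section \<open>The cost of a run\<close>

lemma exec_Cons_iff:
  "exec approx cm X (opn # ops) T c T'' \<longleftrightarrow>
     (\<exists>c1 c2 T'. c = c1 + c2 \<and> step approx cm X opn T c1 T' \<and> exec approx cm X ops T' c2 T'')"
  by (subst exec.simps) auto

lemma exec_Nil_iff: "exec approx cm X [] T c T' \<longleftrightarrow> c = 0 \<and> T' = T"
  by (subst exec.simps) auto

lemma exec_appendE:
  assumes "exec approx cm X (xs @ ys) T c T''"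
  obtains c1 c2 T' where "c = c1 + c2" "exec approx cm X xs T c1 T'" "exec approx cm X ys T' c2 T''"
proof -
  have "\<exists>c1 c2 T'. c = c1 + c2 \<and> exec approx cm X xs T c1 T' \<and> exec approx cm X ys T' c2 T''"
    using assms
  proof (induction xs arbitrary: T c)
    case (Cons opn xs)
    then obtain c0 c' T0 where c: "c = c0 + c'" and first: "step approx cm X opn T c0 T0"
      and "exec approx cm X (xs @ ys) T0 c' T''"
      by (auto simp: exec_Cons_iff)
    then obtain c1 c2 T' where "c' = c1 + c2" "exec approx cm X xs T0 c1 T'"
      "exec approx cm X ys T' c2 T''"
      using Cons.IH by blast
    then have "c = (c0 + c1) + c2 \<and> exec approx cm X (opn # xs) T (c0 + c1) T' \<and>
        exec approx cm X ys T' c2 T''"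
      using c first by (simp add: exec_Cons)
    then show ?case by blast
  qed (simp add: exec_Nil_iff)
  then show thesis using that by blast
qed

text \<open>
  The numbers \<open>d\<^sub>i\<close> are read off the final tree, but they have to bound the sizes while
  level \<open>i\<close> is processed.
\<close>

lemma step_nvars_Super:
  assumes "step approx cm X opn T c T'" "opn \<noteq> MergeLevel i"
  shows "nvars T' (Super i k) = nvars T (Super i k)"
proof (cases opn)
  case (MergeLevel i')
  then show ?thesis
    using assms by (simp add: merge_level_def Let_def)
next
  case (Compress i' j)
  then obtain ps r R Q V where "T' = compress_result i' j ps r R Q V T"
    using assms by (auto simp: compress_step_def Let_def)
  then show ?thesis
    by (simp add: compress_result_def Let_def)
next
  case (Eliminate v)
  then show ?thesis
    using assms by (simp add: eliminate_step_def eliminate_def)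
qed

lemma exec_nvars_Super:
  assumes "exec approx cm X ops T c T'" "MergeLevel i \<notin> set ops"
  shows "nvars T' (Super i k) = nvars T (Super i k)"
  using assms
proof (induction rule: exec.induct)
  case (exec_Cons opn T c T' ops c' T'')
  then show ?case
    using step_nvars_Super[OF exec_Cons.hyps(1)] by auto
qed simp

definition level_operations :: "nat \<Rightarrow> nat \<Rightarrow> operation list" where
  "level_operations g m =
     concat (map (\<lambda>j. [Compress (Suc g) j, Eliminate (Super (Suc g) j), Eliminate (Black (Suc g) j)]) [0..<m])"

lemma hierarchical_factorization_0: "hierarchical_factorization 0 = []"
  by (simp add: hierarchical_factorization_def)

lemma hierarchical_factorization_Suc:
  "hierarchical_factorization (Suc g) =
     MergeLevel (Suc g) # level_operations g (2 ^ g) @ hierarchical_factorization g"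
  by (simp add: hierarchical_factorization_def level_operations_def)

lemma MergeLevel_notin_level_operations: "MergeLevel i \<notin> set (level_operations g m)"
  by (auto simp: level_operations_def)

lemma MergeLevel_notin_factorization: "g < i \<Longrightarrow> MergeLevel i \<notin> set (hierarchical_factorization g)"
  by (auto simp: hierarchical_factorization_def)

lemma process_level:
  assumes X: "partitioned_square_matrix X" and g: "Suc g \<le> depth X"
    and cm: "kernels_bounded C cm" "C \<ge> 0"
    and inv: "invariant X g 0 T"
    and size: "\<forall>u\<in>live_nodes g 0. nvars T u \<le> D"
    and run: "exec approx cm X (level_operations g m) T c T'" and m: "m \<le> 2 ^ g"
  shows "invariant X g m T' \<and> (\<forall>u\<in>live_nodes g m. nvars T' u \<le> D) \<and>
    real c \<le> real m * (cluster_cost C (real (max_neighbours X)) * real D ^ 3)"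
  using run m
proof (induction m arbitrary: c T')
  case 0
  then show ?case
    using inv size by (simp add: level_operations_def exec_Nil_iff)
next
  case (Suc m)
  have "exec approx cm X (level_operations g m @
      [Compress (Suc g) m, Eliminate (Super (Suc g) m), Eliminate (Black (Suc g) m)]) T c T'"
    using Suc.prems(1) by (simp add: level_operations_def)
  then obtain c0 c1 c2 c3 T0 T1 T2 where c: "c = c0 + (c1 + c2 + c3)"
    and run0: "exec approx cm X (level_operations g m) T c0 T0"
    and steps: "compress_step approx cm X (Suc g) m T0 c1 T1"
      "eliminate_step cm (Super (Suc g) m) T1 c2 T2" "eliminate_step cm (Black (Suc g) m) T2 c3 T'"
    by (elim exec_appendE) (auto simp: exec_Cons_iff exec_Nil_iff add.assoc)
  have m: "m < 2 ^ g" "m \<le> 2 ^ g"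
    using Suc.prems(2) by auto
  note IH = Suc.IH[OF run0 m(2)]
  note process_cluster[OF X g m(1) conjunct1[OF IH] _ cm steps, of D]
  then show ?case
    using IH by (simp add: c algebra_simps)
qed

lemma super_size_le_max:
  assumes "k < 2 ^ g"
  shows "nvars H (Super (Suc g) k) \<le> max_super_size H (Suc g)"
  unfolding max_super_size_def using assms by (intro Max_ge) auto

text \<open>
  The algorithm on the levels up to \<open>g + 1\<close> continues, after its first level, as the algorithm on the
  levels up to \<open>g\<close>.  For an induction on \<open>g\<close> the initial tree is therefore replaced by any tree that
  satisfies the invariant, whereas the final tree, which determines the sizes, is the same for all \<open>g\<close>.
\<close>

lemma factorization_cost_le:
  assumes X: "partitioned_square_matrix X"
    and cm: "kernels_bounded C cm" "C \<ge> 0"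
    and "g \<le> depth X" "invariant X g (2 ^ g) T"
    and "exec approx cm X (hierarchical_factorization g) T c H"
  shows "real c \<le> cluster_cost C (real (max_neighbours X)) *
    (\<Sum>h<g. 2 ^ h * real (max_super_size H (Suc h)) ^ 3)"
  using assms(4-6)
proof (induction g arbitrary: T c)
  case 0
  then show ?case
    by (simp add: hierarchical_factorization_0 exec_Nil_iff)
next
  case (Suc g)
  let ?T1 = "merge_level X (Suc g) T" and ?D = "max_super_size H (Suc g)"
  obtain c1 c2 T2 where c: "c = c1 + c2"
    and run1: "exec approx cm X (level_operations g (2 ^ g)) ?T1 c1 T2"
    and run2: "exec approx cm X (hierarchical_factorization g) T2 c2 H"
    using Suc.prems(3) by (auto simp: hierarchical_factorization_Suc exec_Cons_iff elim: exec_appendE)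
  have same: "nvars ?T1 (Super (Suc g) k) = nvars H (Super (Suc g) k)" for k
    using exec_nvars_Super[OF run1 MergeLevel_notin_level_operations]
      exec_nvars_Super[OF run2 MergeLevel_notin_factorization[OF lessI]] by simp
  then have "\<forall>u\<in>live_nodes g 0. nvars ?T1 u \<le> ?D"
    using super_size_le_max by (auto simp: live_nodes_def same)
  with process_level[OF X Suc.prems(1) cm invariant_merge_level[OF X Suc.prems(1,2)] _ run1, of ?D]
  have "invariant X g (2 ^ g) T2"
    and "real c1 \<le> 2 ^ g * (cluster_cost C (real (max_neighbours X)) * real ?D ^ 3)"
    by simp_all
  with Suc.IH[OF _ _ run2] Suc.prems(1) show ?case
    by (simp add: c algebra_simps)
qed

section \<open>Summation over the levels\<close>

lemma cluster_cost_mono: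
  assumes "C \<ge> 0" "0 \<le> K" "K \<le> K'"
  shows "cluster_cost C K \<le> cluster_cost C K'"
  unfolding cluster_cost_def using assms
  by (intro add_mono mult_left_mono mult_right_mono power_mono order_refl) auto

lemma cluster_cost_nonneg: "C \<ge> 0 \<Longrightarrow> K \<ge> 0 \<Longrightarrow> cluster_cost C K \<ge> 0"
  by (simp add: cluster_cost_def)

text \<open>
  Towards the root, the number of clusters halves per level while the cubes of their sizes
  grow at most by the factor \<open>\<alpha>\<^sup>3\<close>, so for \<open>\<alpha>\<^sup>3 < 2\<close> the leaf level dominates.  With \<open>q = \<alpha>\<^sup>3\<close>, the
  sum over the levels is the cofactor of \<open>2 - q\<close> in \<open>2 ^ l - q ^ l\<close>.
\<close>

lemma sum_levels_le:
  fixes d :: "nat \<Rightarrow> real"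
  assumes "0 < \<alpha>" "\<alpha> ^ 3 < 2" and d: "\<And>i. d i \<ge> 0"
    and decay: "\<And>i. 1 \<le> i \<Longrightarrow> i \<le> l \<Longrightarrow> d i \<le> \<alpha> ^ (l - i) * d l"
  shows "(\<Sum>h<l. 2 ^ h * d (Suc h) ^ 3) \<le> 2 ^ l * d l ^ 3 / (2 - \<alpha> ^ 3)"
proof -
  let ?q = "\<alpha> ^ 3"
  have "(\<Sum>h<l. 2 ^ h * d (Suc h) ^ 3) \<le> (\<Sum>h<l. 2 ^ h * (?q ^ (l - Suc h) * d l ^ 3))"
  proof (intro sum_mono mult_left_mono)
    fix h assume "h \<in> {..<l}"
    then have "d (Suc h) ^ 3 \<le> (\<alpha> ^ (l - Suc h) * d l) ^ 3"
      using d by (intro power_mono decay) auto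
    then show "d (Suc h) ^ 3 \<le> ?q ^ (l - Suc h) * d l ^ 3"
      by (simp add: power_mult_distrib mult.commute flip: power_mult)
  qed simp
  also have "\<dots> = (\<Sum>h<l. ?q ^ (l - Suc h) * 2 ^ h) * d l ^ 3"
    by (subst sum_distrib_right) (simp add: mult_ac)
  also have "(\<Sum>h<l. ?q ^ (l - Suc h) * 2 ^ h) = (2 ^ l - ?q ^ l) / (2 - ?q)"
    using assms(2) by (simp add: power_diff_sumr2[of 2 l ?q])
  also have "\<dots> * d l ^ 3 \<le> 2 ^ l / (2 - ?q) * d l ^ 3"
    using assms(1,2) d by (intro mult_right_mono divide_right_mono) auto
  finally show ?thesis by simp
qed

lemma bigo_principal_bound:
  fixes f g :: "'i \<Rightarrow> real"
  assumes "f \<in> O[principal I](g)"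
  obtains c where "c \<ge> 0" "\<And>i. i \<in> I \<Longrightarrow> \<bar>f i\<bar> \<le> c * \<bar>g i\<bar>"
proof -
  from assms obtain c where "c > 0" "\<forall>i\<in>I. \<bar>f i\<bar> \<le> c * \<bar>g i\<bar>"
    by (elim landau_o.bigE) (auto simp: eventually_principal)
  then show thesis
    using that[of c] by simp
qed

theorem theorem5p4:
  fixes I :: "'i set"
    and X :: "'i \<Rightarrow> 'a :: field partitioned_matrix"
    and approx :: "'a mat \<Rightarrow> 'a mat \<Rightarrow> bool"
    and cm :: cost_model
    and cost :: "'i \<Rightarrow> nat"
    and H :: "'i \<Rightarrow> 'a htree"
    and n l :: "'i \<Rightarrow> nat"
    and d :: "'i \<Rightarrow> nat \<Rightarrow> nat"
    and \<alpha> :: real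
  defines "n \<equiv> \<lambda>f. order_of (X f)"
    and "l \<equiv> \<lambda>f. depth (X f)"
    and "d \<equiv> \<lambda>f. max_super_size (H f)"
  assumes "classical_cubic_cost cm"
    and "\<And>f. f \<in> I \<Longrightarrow> partitioned_square_matrix (X f)"
    and "\<And>f. f \<in> I \<Longrightarrow> factorization_run approx cm (X f) (cost f) (H f)"
    and "0 < \<alpha>" and "\<alpha> < root 3 2"
    and "\<And>f i. f \<in> I \<Longrightarrow> 1 \<le> i \<Longrightarrow> i \<le> l f \<Longrightarrow> real (d f i) \<le> \<alpha> ^ (l f - i) * real (d f (l f))"
    and "(\<lambda>f. real (d f (l f))) \<in> O[principal I](\<lambda>f. real (n f) / 2 ^ l f)"
    and "(\<lambda>f. real (n f) / 2 ^ l f) \<in> O[principal I](\<lambda>f. 1)"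
    and "(\<lambda>f. real (kappa (X f) 1)) \<in> O[principal I](\<lambda>f. 1)"
    and "(\<lambda>f. real (kappa (X f) 2)) \<in> O[principal I](\<lambda>f. 1)"
  shows "(\<lambda>f. real (cost f)) \<in> O[principal I](\<lambda>f. real (n f))"
proof -
  obtain C where C: "C \<ge> 0" "kernels_bounded C cm"
    using classical_cubic_cost_bounded assms(4) .
  obtain a where a: "a \<ge> 0" "\<And>f. f \<in> I \<Longrightarrow> real (d f (l f)) \<le> a * (real (n f) / 2 ^ l f)"
    using bigo_principal_bound[OF assms(10)] by auto
  obtain e where e: "e \<ge> 0" "\<And>f. f \<in> I \<Longrightarrow> real (n f) / 2 ^ l f \<le> e"
    using bigo_principal_bound[OF assms(11)] by auto
  obtain k1 where k1: "k1 \<ge> 0" "\<And>f. f \<in> I \<Longrightarrow> real (kappa (X f) 1) \<le> k1"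
    using bigo_principal_bound[OF assms(12)] by auto
  obtain k2 where k2: "k2 \<ge> 0" "\<And>f. f \<in> I \<Longrightarrow> real (kappa (X f) 2) \<le> k2"
    using bigo_principal_bound[OF assms(13)] by auto
  have "\<alpha> ^ 3 < root 3 2 ^ 3"
    using assms(7,8) by (intro power_strict_mono) auto
  then have \<alpha>: "\<alpha> ^ 3 < 2" by simp
  define W where "W = cluster_cost C (3 * (1 + k1 + k2))"
  have W: "W \<ge> 0"
    unfolding W_def using C k1 k2 by (intro cluster_cost_nonneg) auto
  have "real (cost f) \<le> W * (a ^ 3 * e\<^sup>2 / (2 - \<alpha> ^ 3)) * real (n f)" if f: "f \<in> I" for f
  proof -
    let ?K = "real (max_neighbours (X f))" and ?S = "\<Sum>h<l f. 2 ^ h * real (d f (Suc h)) ^ 3"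
    let ?leaf = "real (n f) / 2 ^ l f"
    \<comment> \<open>One factor \<open>n / 2 ^ l\<close> cancels the number of leaves, the other two are bounded by \<open>e\<close>.\<close>
    have "2 ^ l f * real (d f (l f)) ^ 3 \<le> 2 ^ l f * (a * ?leaf) ^ 3"
      using a(2)[OF f] by (intro mult_left_mono power_mono) auto
    also have "\<dots> = a ^ 3 * ?leaf\<^sup>2 * real (n f)"
      by (simp add: field_simps power2_eq_square power3_eq_cube)
    also have "\<dots> \<le> a ^ 3 * e\<^sup>2 * real (n f)"
      using a(1) e(2)[OF f] by (intro mult_right_mono mult_left_mono power_mono) auto
    finally have leaves: "2 ^ l f * real (d f (l f)) ^ 3 \<le> a ^ 3 * e\<^sup>2 * real (n f)" .
    have "real (cost f) \<le> cluster_cost C ?K * ?S"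
      using factorization_cost_le[OF assms(5)[OF f] C(2,1) order_refl invariant_initial[OF assms(5)[OF f]]]
        assms(6)[OF f] unfolding factorization_run_def l_def d_def by blast
    also have "\<dots> \<le> W * ?S"
    proof (rule mult_right_mono)
      show "cluster_cost C ?K \<le> W"
        unfolding W_def using C(1) k1(2)[OF f] k2(2)[OF f]
        by (intro cluster_cost_mono) (auto simp: max_neighbours_def)
    qed (simp add: sum_nonneg)
    also have "\<dots> \<le> W * (2 ^ l f * real (d f (l f)) ^ 3 / (2 - \<alpha> ^ 3))"
      using W sum_levels_le[OF assms(7) \<alpha> _ assms(9)[OF f]] by (intro mult_left_mono) auto
    also have "\<dots> \<le> W * (a ^ 3 * e\<^sup>2 * real (n f) / (2 - \<alpha> ^ 3))"
      using W \<alpha> leaves by (intro mult_left_mono divide_right_mono) auto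
    also have "\<dots> = W * (a ^ 3 * e\<^sup>2 / (2 - \<alpha> ^ 3)) * real (n f)"
      by simp
    finally show ?thesis .
  qed
  then show ?thesis
    by (intro bigoI[of _ "W * (a ^ 3 * e\<^sup>2 / (2 - \<alpha> ^ 3))"]) (auto simp: eventually_principal)
qed

end
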